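(* Let $\mathcal{H}$ be a template, let $T=T(\mathcal{H})$ be the model completion of $T_0(\mathcal{H})$, and let $M\models T$. Let $\mathcal{D}$ be a regular ultrafilter on a set $I$ with $|I|=\lambda$ (an infinite cardinal) which is flexible and good for the random graph. Then $M^I/\mathcal{D}$ is $\lambda^+$-saturated.
   Context: **$k$-full hypergraphs.** A pair $(H,E)$ with $E\subseteq H^k$ is a $k$-full hypergraph if $E=E^*\cup E^{<k}$ is a partition where $E^*$ is symmetric and holds only on $k$-tuples of $k$ distinct elements, and $E^{<k}$ is the set of all $k$-tuples from $H$ with fewer than $k$ distinct entries. **Templates.** A template of arity $k$ ($2\le k<\omega$) is a sequence $\mathcal{H}=\langle \mathbf{h}_n:n<\omega\rangle$ such that there is a function $f_{\mathcal H}:\omega\to\omega\setminus\{0\}$ with: (0) $\lim_{n\to\infty} f_{\mathcal H}(n)=\infty$; (1) for all $n$, $\mathbf{h}_n=(H_n,E_n)$ is a finite $k$-full hypergraph, whose vertex set is identified with $\{0,\dots,H_n-1\}$ (the symbol $H_n$ is used both for the vertex set and for its cardinality $\|\mathbf{h}_n\|$); (2) $f_{\mathcal H}(n)\le H_n<\aleph_0$; (3) (Extension) with $t=f_{\mathcal H}(n)$, for any vertices $i^0_0,\dots,i^0_{k-2},\dots,i^{t-1}_0,\dots,i^{t-1}_{k-2}\in H_n$ there is $s\in H_n$ with $\langle s,i^\ell_0,\dots,i^\ell_{k-2}\rangle\in E_n$ for all $\ell<t$. A template is a template of arity $k$ for some such $k$. **The tree.** $X_{\mathcal H}$ is the set of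 finite sequences $\rho$ of natural numbers with $\rho(n)<H_n$ for all $n<\mathrm{lgn}(\rho)$, where $\mathrm{lgn}$ denotes length. $\eta\trianglelefteq\nu$ means $\eta$ is an initial segment of $\nu$. **The theory $T_0=T_0(\mathcal H)$.** Its language has equality, a $k$-place relation $R$, and unary predicates $Q_\eta$ for $\eta\in X_{\mathcal H}$. Its axioms state: (i) $R$ is symmetric and holds only on $k$-tuples of distinct elements; (ii) $\forall x\,Q_{\langle\rangle}(x)$, and $\forall x(Q_\nu(x)\to Q_\eta(x))$ whenever $\eta\trianglelefteq\nu\in X_{\mathcal H}$; (iii) for each $\eta\in X_{\mathcal H}$ of length $m$, the predicates $Q_{\eta^{\frown}\langle i\rangle}$, $i<\|\mathbf{h}_m\|$, partition $Q_\eta$ (where $\eta^{\frown}\langle i\rangle$ is the concatenation of $\eta$ with the one-term sequence $\langle i\rangle$); (iv) for all $\eta_0,\dots,\eta_{k-1}\in X_{\mathcal H}$ and $n<\min_i \mathrm{lgn}(\eta_i)$, if $\langle\eta_0(n),\dots,\eta_{k-1}(n)\rangle\notin E_n$ then $\forall x_0\dots x_{k-1}\,(Q_{\eta_0}(x_0)\wedge\dots\wedge Q_{\eta_{k-1}}(x_{k-1})\to\neg R(x_0,\dots,x_{k-1}))$. $T_0$ has a model completion $T=T(\mathcal H)$, which is complete and eliminates quantifiers. **Regular.** $\mathcal{D}$ on $I$, $|I|=\lambda$, is regular if there is $\{X_\alpha:\alpha<\lambda\}\subseteq\mathcal{D}$ such that each $i\in I$ belongs to only finitely many $X_\alpha$.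 **Flexible.** $\mathcal{D}$ is flexible if for every sequence $\langle n_i:i\in I\rangle$ of natural numbers with $\prod_{i\in I}n_i/\mathcal{D}>\aleph_0$ (i.e. $\langle n_i : i\in I\rangle/\mathcal{D}$ is a nonstandard integer) there is $\{X_\alpha:\alpha<\lambda\}\subseteq\mathcal{D}$ such that $|\{\alpha<\lambda:i\in X_\alpha\}|\le n_i$ for all $i\in I$. **Good for the random graph.** A regular ultrafilter $\mathcal{D}$ on $I$, $|I|=\lambda$, is good for the random graph iff for any infinite $M$ and any $A,B\subseteq M^I/\mathcal{D}$ with $|A|+|B|\le\lambda$ and $A\cap B=\emptyset$, there is an internal predicate $P$ (i.e. $P=\prod_{i\in I}P_i/\mathcal{D}$ with $P_i\subseteq M$) such that $A\subseteq P$ and $B\cap P=\emptyset$. (Equivalently, ultrapowers by $\mathcal D$ of models of the theory of the random graph are $\lambda^+$-saturated.) *)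

theory Defs
  imports Main "HOL-Library.FuncSet" "HOL-Library.Sublist" "HOL-Combinatorics.Permutations"
begin

unbundle cardinal_syntax

section \<open>First-order logic over a relational language\<close>

text \<open>A language is a partial arity function; the symbols of the language are those in its domain.
  Variables are natural numbers. All structures have a carrier set, so that structures of various
  sizes can live in one type.\<close>

type_synonym 'r lang = "'r \<rightharpoonup> nat"

datatype 'r fm =
    Bot
  | Eq nat nat
  | Rel 'r "nat list"
  | Imp "'r fm" "'r fm"
  | All nat "'r fm"

definition Neg :: "'r fm \<Rightarrow> 'r fm" where "Neg p = Imp p Bot"
definition And :: "'r fm \<Rightarrow> 'r fm \<Rightarrow> 'r fm" where "And p q = Neg (Imp p (Neg q))"
definition Or :: "'r fm \<Rightarrow> 'r fm \<Rightarrow> 'r fm" where "Or p q = Imp (Neg p) q"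
definition Iff :: "'r fm \<Rightarrow> 'r fm \<Rightarrow> 'r fm" where "Iff p q = And (Imp p q) (Imp q p)"
definition Ands :: "'r fm list \<Rightarrow> 'r fm" where "Ands ps = foldr And ps (Neg Bot)"
definition Ors :: "'r fm list \<Rightarrow> 'r fm" where "Ors ps = foldr Or ps Bot"
definition Alls :: "nat \<Rightarrow> 'r fm \<Rightarrow> 'r fm" where "Alls n p = foldr All [0..<n] p"

fun free_vars :: "'r fm \<Rightarrow> nat set" where
  "free_vars Bot = {}"
| "free_vars (Eq x y) = {x, y}"
| "free_vars (Rel r xs) = set xs"
| "free_vars (Imp p q) = free_vars p \<union> free_vars q"
| "free_vars (All x p) = free_vars p - {x}"

fun is_fm :: "'r lang \<Rightarrow> 'r fm \<Rightarrow> bool" where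
  "is_fm L Bot \<longleftrightarrow> True"
| "is_fm L (Eq x y) \<longleftrightarrow> True"
| "is_fm L (Rel r xs) \<longleftrightarrow> L r = Some (length xs)"
| "is_fm L (Imp p q) \<longleftrightarrow> is_fm L p \<and> is_fm L q"
| "is_fm L (All x p) \<longleftrightarrow> is_fm L p"

definition is_theory :: "'r lang \<Rightarrow> 'r fm set \<Rightarrow> bool" where
  "is_theory L T \<longleftrightarrow> (\<forall>p\<in>T. is_fm L p \<and> free_vars p = {})"

definition tuples :: "nat \<Rightarrow> 'a set \<Rightarrow> 'a list set" where
  "tuples n A = {xs. length xs = n \<and> set xs \<subseteq> A}"

record ('r, 'a) struct =
  carrier :: "'a set"
  interp :: "'r \<Rightarrow> 'a list set"

definition is_struct :: "'r lang \<Rightarrow> ('r, 'a) struct \<Rightarrow> bool" where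
  "is_struct L M \<longleftrightarrow> carrier M \<noteq> {} \<and> (\<forall>r n. L r = Some n \<longrightarrow> interp M r \<subseteq> tuples n (carrier M))"

fun sat :: "('r, 'a) struct \<Rightarrow> (nat \<Rightarrow> 'a) \<Rightarrow> 'r fm \<Rightarrow> bool" where
  "sat M v Bot \<longleftrightarrow> False"
| "sat M v (Eq x y) \<longleftrightarrow> v x = v y"
| "sat M v (Rel r xs) \<longleftrightarrow> map v xs \<in> interp M r"
| "sat M v (Imp p q) \<longleftrightarrow> (sat M v p \<longrightarrow> sat M v q)"
| "sat M v (All x p) \<longleftrightarrow> (\<forall>a\<in>carrier M. sat M (v(x := a)) p)"

definition models :: "'r lang \<Rightarrow> ('r, 'a) struct \<Rightarrow> 'r fm set \<Rightarrow> bool" where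
  "models L M T \<longleftrightarrow> is_struct L M \<and> (\<forall>p\<in>T. \<forall>v\<in>UNIV \<rightarrow> carrier M. sat M v p)"

definition is_embedding ::
  "'r lang \<Rightarrow> ('a \<Rightarrow> 'b) \<Rightarrow> ('r, 'a) struct \<Rightarrow> ('r, 'b) struct \<Rightarrow> bool" where
  "is_embedding L e M N \<longleftrightarrow> e \<in> carrier M \<rightarrow> carrier N \<and> inj_on e (carrier M) \<and>
     (\<forall>r n. L r = Some n \<longrightarrow>
        (\<forall>xs\<in>tuples n (carrier M). xs \<in> interp M r \<longleftrightarrow> map e xs \<in> interp N r))"

text \<open>\<open>T\<close> is a model completion of \<open>T0\<close> if \<open>T\<close> extends \<open>T0\<close>, every model \<open>A\<close> of \<open>T0\<close> embeds into a
  model of \<open>T\<close>, and for every such \<open>A\<close> the theory consisting of \<open>T\<close> and the quantifier-free diagram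
  of \<open>A\<close> is complete; a model of the latter theory is a model \<open>N\<close> of \<open>T\<close> with an embedding of \<open>A\<close>
  into \<open>N\<close>.

  HOL cannot quantify over types, so the models range over the structures whose carrier is a subset
  of the type \<open>'a\<close> (this is why embeddings replace extensions). For countable languages, the
  Loewenheim-Skolem theorem shows that any infinite type \<open>'a\<close> gives the same notion as the class of
  all structures.\<close>

definition is_model_completion :: "'a itself \<Rightarrow> 'r lang \<Rightarrow> 'r fm set \<Rightarrow> 'r fm set \<Rightarrow> bool" where
  "is_model_completion _ L T0 T \<longleftrightarrow>
     is_theory L T0 \<and> is_theory L T \<and>
     (\<forall>N :: ('r, 'a) struct. models L N T \<longrightarrow> models L N T0) \<and>
     (\<forall>A :: ('r, 'a) struct. models L A T0 \<longrightarrow>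
        (\<exists>(N :: ('r, 'a) struct) e. models L N T \<and> is_embedding L e A N)) \<and>
     (\<forall>(A :: ('r, 'a) struct) (N1 :: ('r, 'a) struct) e1 (N2 :: ('r, 'a) struct) e2 p v.
        models L A T0 \<and>
        models L N1 T \<and> is_embedding L e1 A N1 \<and> models L N2 T \<and> is_embedding L e2 A N2 \<and>
        is_fm L p \<and> v \<in> UNIV \<rightarrow> carrier A \<longrightarrow>
        (sat N1 (e1 \<circ> v) p \<longleftrightarrow> sat N2 (e2 \<circ> v) p))"

text \<open>\<open>\<kappa>\<close>-saturation. A pair \<open>(p, v)\<close> stands for the formula \<open>p\<close> in which every free variable
  \<open>x \<noteq> 0\<close> is replaced by the parameter \<open>v x\<close>; variable \<open>0\<close> is the variable of the type.\<close>

definition saturated :: "'c rel \<Rightarrow> 'r lang \<Rightarrow> ('r, 'a) struct \<Rightarrow> bool" where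
  "saturated \<kappa> L N \<longleftrightarrow>
     (\<forall>A \<Sigma>. A \<subseteq> carrier N \<and> |A| <o \<kappa> \<and>
        (\<forall>(p, v)\<in>\<Sigma>. is_fm L p \<and> (\<forall>x\<in>free_vars p - {0}. v x \<in> A)) \<and>
        (\<forall>\<Delta>\<subseteq>\<Sigma>. finite \<Delta> \<longrightarrow> (\<exists>b\<in>carrier N. \<forall>(p, v)\<in>\<Delta>. sat N (v(0 := b)) p)) \<longrightarrow>
        (\<exists>b\<in>carrier N. \<forall>(p, v)\<in>\<Sigma>. sat N (v(0 := b)) p))"


section \<open>Ultrafilters and ultrapowers\<close>

text \<open>The index set \<open>I\<close> is the type \<open>'i\<close>, so \<open>\<lambda>\<close> is the cardinal \<open>|UNIV :: 'i set|\<close> and families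
  \<open>(X \<alpha>)\<close>, \<open>\<alpha> < \<lambda>\<close>, are indexed by \<open>'i\<close> itself. A set \<open>X\<close> belongs to the filter \<open>D\<close> iff
  \<open>\<forall>\<^sub>F i in D. i \<in> X\<close>.\<close>

definition is_ultrafilter :: "'i filter \<Rightarrow> bool" where
  "is_ultrafilter D \<longleftrightarrow>
     D \<noteq> bot \<and> (\<forall>P. (\<forall>\<^sub>F i in D. P i) \<or> (\<forall>\<^sub>F i in D. \<not> P i))"

definition is_regular :: "'i filter \<Rightarrow> bool" where
  "is_regular D \<longleftrightarrow>
     (\<exists>X :: 'i \<Rightarrow> 'i set. (\<forall>\<alpha>. \<forall>\<^sub>F i in D. i \<in> X \<alpha>) \<and> (\<forall>i. finite {\<alpha>. i \<in> X \<alpha>}))"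

definition is_nonstandard :: "'i filter \<Rightarrow> ('i \<Rightarrow> nat) \<Rightarrow> bool" where
  "is_nonstandard D n \<longleftrightarrow> (\<forall>m. \<not> (\<forall>\<^sub>F i in D. n i = m))"

definition is_flexible :: "'i filter \<Rightarrow> bool" where
  "is_flexible D \<longleftrightarrow>
     (\<forall>n. is_nonstandard D n \<longrightarrow>
        (\<exists>X :: 'i \<Rightarrow> 'i set. (\<forall>\<alpha>. \<forall>\<^sub>F i in D. i \<in> X \<alpha>) \<and>
           (\<forall>i. finite {\<alpha>. i \<in> X \<alpha>} \<and> card {\<alpha>. i \<in> X \<alpha>} \<le> n i)))"

definition upower_rel :: "'i filter \<Rightarrow> 'a set \<Rightarrow> ('i \<Rightarrow> 'a) rel" where
  "upower_rel D M = {(f, g). f \<in> UNIV \<rightarrow> M \<and> g \<in> UNIV \<rightarrow> M \<and> (\<forall>\<^sub>F i in D. f i = g i)}"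

definition upower_set :: "'i filter \<Rightarrow> 'a set \<Rightarrow> ('i \<Rightarrow> 'a) set set" where
  "upower_set D M = (UNIV \<rightarrow> M) // upower_rel D M"

definition internal_set :: "'i filter \<Rightarrow> 'a set \<Rightarrow> ('i \<Rightarrow> 'a set) \<Rightarrow> ('i \<Rightarrow> 'a) set set" where
  "internal_set D M P = {c \<in> upower_set D M. \<exists>f\<in>c. \<forall>\<^sub>F i in D. f i \<in> P i}"

definition ultrapower :: "'i filter \<Rightarrow> ('r, 'a) struct \<Rightarrow> ('r, ('i \<Rightarrow> 'a) set) struct" where
  "ultrapower D M =
     \<lparr> carrier = upower_set D (carrier M),
       interp = (\<lambda>r. {cs. set cs \<subseteq> upower_set D (carrier M) \<and>
         (\<exists>fs. list_all2 (\<in>) fs cs \<and> (\<forall>\<^sub>F i in D. map (\<lambda>f. f i) fs \<in> interp M r))}) \<rparr>"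

text \<open>As in \<^const>\<open>is_model_completion\<close>, the sets \<open>M\<close> range over the subsets of a type. For a
  regular ultrafilter all infinite types (indeed all infinite sets \<open>M\<close>) give the same notion.\<close>

definition good_for_random_graph :: "'a itself \<Rightarrow> 'i filter \<Rightarrow> bool" where
  "good_for_random_graph _ D \<longleftrightarrow>
     (\<forall>(M :: 'a set) A B. infinite M \<and> A \<subseteq> upower_set D M \<and> B \<subseteq> upower_set D M \<and>
        |A| +c |B| \<le>o |UNIV :: 'i set| \<and> A \<inter> B = {} \<longrightarrow>
        (\<exists>P. (\<forall>i. P i \<subseteq> M) \<and> A \<subseteq> internal_set D M P \<and> B \<inter> internal_set D M P = {}))"


section \<open>Templates and their theories\<close>

definition symmetric_tuples :: "'a list set \<Rightarrow> bool" where
  "symmetric_tuples E \<longleftrightarrow> (\<forall>xs\<in>E. \<forall>\<sigma>. \<sigma> permutes {..<length xs} \<longrightarrow> permute_list \<sigma> xs \<in> E)"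

definition full_hypergraph :: "nat \<Rightarrow> 'a set \<Rightarrow> 'a list set \<Rightarrow> bool" where
  "full_hypergraph k V E \<longleftrightarrow>
     (\<exists>E'. E' \<subseteq> {xs \<in> tuples k V. distinct xs} \<and> symmetric_tuples E' \<and>
        E = E' \<union> {xs \<in> tuples k V. card (set xs) < k})"

text \<open>The \<open>n\<close>-th hypergraph of a template has vertex set \<open>{..<H n}\<close> and edge set \<open>E n\<close>.\<close>

definition is_template :: "nat \<Rightarrow> (nat \<Rightarrow> nat) \<Rightarrow> (nat \<Rightarrow> nat list set) \<Rightarrow> bool" where
  "is_template k H E \<longleftrightarrow> 2 \<le> k \<and>
     (\<exists>f :: nat \<Rightarrow> nat. (\<forall>n. f n \<noteq> 0) \<and> filterlim f at_top sequentially \<and>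
        (\<forall>n. full_hypergraph k {..<H n} (E n)) \<and>
        (\<forall>n. f n \<le> H n) \<and>
        (\<forall>n iss. length iss = f n \<and> set iss \<subseteq> tuples (k - 1) {..<H n} \<longrightarrow>
           (\<exists>s<H n. \<forall>l<f n. s # iss ! l \<in> E n)))"

definition tree :: "(nat \<Rightarrow> nat) \<Rightarrow> nat list set" where
  "tree H = {\<rho>. \<forall>n<length \<rho>. \<rho> ! n < H n}"

datatype sym = R | Q "nat list"

fun T0_lang :: "nat \<Rightarrow> (nat \<Rightarrow> nat) \<Rightarrow> sym lang" where
  "T0_lang k H R = Some k"
| "T0_lang k H (Q \<eta>) = (if \<eta> \<in> tree H then Some 1 else None)"

abbreviation R_fm :: "nat list \<Rightarrow> sym fm" where "R_fm xs \<equiv> Rel R xs"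
abbreviation Q_fm :: "nat list \<Rightarrow> nat \<Rightarrow> sym fm" where "Q_fm \<eta> x \<equiv> Rel (Q \<eta>) [x]"

text \<open>The pieces of the partition in the third group of axioms may be empty.\<close>

definition T0 :: "nat \<Rightarrow> (nat \<Rightarrow> nat) \<Rightarrow> (nat \<Rightarrow> nat list set) \<Rightarrow> sym fm set" where
  "T0 k H E =
     {Alls k (Imp (R_fm [0..<k]) (R_fm (permute_list \<sigma> [0..<k]))) | \<sigma>. \<sigma> permutes {..<k}} \<union>
     {Alls k (Imp (R_fm [0..<k]) (Neg (Eq i j))) | i j. i < j \<and> j < k} \<union>
     {All 0 (Q_fm [] 0)} \<union>
     {All 0 (Imp (Q_fm \<nu> 0) (Q_fm \<eta> 0)) | \<eta> \<nu>. \<nu> \<in> tree H \<and> prefix \<eta> \<nu>} \<union>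
     {All 0 (Iff (Q_fm \<eta> 0) (Ors (map (\<lambda>i. Q_fm (\<eta> @ [i]) 0) [0..<H (length \<eta>)])))
        | \<eta>. \<eta> \<in> tree H} \<union>
     {All 0 (Neg (And (Q_fm (\<eta> @ [i]) 0) (Q_fm (\<eta> @ [j]) 0)))
        | \<eta> i j. \<eta> \<in> tree H \<and> i < j \<and> j < H (length \<eta>)} \<union>
     {Alls k (Imp (Ands (map (\<lambda>j. Q_fm (\<eta>s ! j) j) [0..<k])) (Neg (R_fm [0..<k])))
        | \<eta>s n. \<eta>s \<in> tuples k (tree H) \<and> (\<forall>\<eta>\<in>set \<eta>s. n < length \<eta>) \<and>
            map (\<lambda>\<eta>. \<eta> ! n) \<eta>s \<notin> E n}"

end

theory Submission
  imports Defs
begin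

text \<open>Since \<open>M\<close> is elementary in every model of \<open>T\<close> extending it, \<open>M\<close> realizes every finite one-point
  extension that is consistent with \<open>T0\<close>. By the extension property of the template, an extension
  that prescribes a stem of length \<open>m\<close> of the branch and \<open>t\<close> positive instances of \<open>R\<close> is consistent as
  soon as these agree on the levels below \<open>m\<close> and \<open>f n \<ge> t\<close> for all \<open>n \<ge> m\<close>. A back-and-forth argument
  then shows that every formula depends only on equality, finitely many levels of the branches and \<open>R\<close>.

  In the ultrapower, a type over \<open>A\<close> is completed to an ultrafilter on the ultrapower, which determines a
  branch \<open>\<beta>\<close> and splits the \<open>(k - 1)\<close>-subsets of \<open>A\<close> into a positive part \<open>X\<close> and a negative part \<open>Y\<close>.
  Goodness for the random graph yields an internal set separating \<open>X\<close> from \<open>Y\<close>, and also a nonstandard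
  level \<open>m\<close> up to which every member of \<open>X\<close> is almost everywhere compatible with \<open>\<beta>\<close>. Then
  \<open>t i = min {f n | n. n \<ge> m i}\<close> is nonstandard, so by flexibility each index \<open>i\<close> has to deal with at most
  \<open>t i\<close> members of \<open>X\<close>, and these are handled by a one-point extension inside \<open>M\<close>.\<close>

section \<open>Ultrafilters and cardinalities\<close>

text \<open>By induction there are at most \<open>|A|\<close> subsets of size \<open>n\<close>,
  since a set of size \<open>n + 1\<close> is \<open>insert a S\<close> for a pair
  \<open>(a, S)\<close> in \<open>A \<times> F n\<close>; a countable union of such families is no
  larger. The injection codes finite sets as elements, so that properties stated for elements of an
  ultrapower can be applied to finite sets.\<close>

lemma Fpow_inj:
  assumes "infinite A"
  shows "\<exists>c. inj_on c (Fpow A) \<and> c ` Fpow A \<subseteq> A"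
proof -
  define F where "F n = {S. S \<subseteq> A \<and> finite S \<and> card S = n}" for n
  have F: "|F n| \<le>o |A|" for n
  proof (induction n)
    case 0
    have "F 0 = {{}}" by (auto simp: F_def)
    moreover obtain a where "a \<in> A" using assms by fastforce
    ultimately show ?case by (auto intro!: card_of_ordLeqI[of "\<lambda>_. a"])
  next
    case (Suc n)
    have "F (Suc n) \<subseteq> (\<lambda>(a, S). insert a S) ` (A \<times> F n)"
    proof
      fix S assume "S \<in> F (Suc n)"
      then have S: "S \<subseteq> A" "finite S" "card S = Suc n" by (auto simp: F_def)
      then obtain a T where "S = insert a T" "a \<notin> T" "card T = n" by (metis card_Suc_eq)
      with S show "S \<in> (\<lambda>(a, S). insert a S) ` (A \<times> F n)" by (auto simp: F_def intro!: image_eqI[of _ _ "(a, T)"])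
    qed
    then have "|F (Suc n)| \<le>o |A \<times> F n|"
      by (meson card_of_image card_of_mono1 ordLeq_transitive)
    also have "|A \<times> F n| \<le>o |A|"
      by (rule card_of_Times_ordLeq_infinite_Field) (use assms Suc in \<open>auto simp: Field_card_of card_of_card_order_on intro: card_of_mono1\<close>)
    finally show ?case .
  qed
  have "Fpow A = (\<Union>n. F n)" by (auto simp: F_def Fpow_def)
  then have "|Fpow A| \<le>o |A|"
    using card_of_UNION_ordLeq_infinite[OF assms, of "UNIV :: nat set" F] F assms
    by (simp add: infinite_iff_card_of_nat)
  then show ?thesis by (simp add: card_of_ordLeq)
qed

lemma ultrafilter_nontrivial: "is_ultrafilter D \<Longrightarrow> D \<noteq> bot"
  by (simp add: is_ultrafilter_def)

lemma ultrafilter_not: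
  assumes "is_ultrafilter D"
  shows "(\<not> (\<forall>\<^sub>F x in D. P x)) \<longleftrightarrow> (\<forall>\<^sub>F x in D. \<not> P x)"
proof
  show "\<not> (\<forall>\<^sub>F x in D. P x) \<Longrightarrow> \<forall>\<^sub>F x in D. \<not> P x"
    using assms by (auto simp: is_ultrafilter_def)
  assume A: "\<forall>\<^sub>F x in D. \<not> P x"
  show "\<not> (\<forall>\<^sub>F x in D. P x)"
  proof
    assume "\<forall>\<^sub>F x in D. P x"
    with A have "\<forall>\<^sub>F x in D. False" by eventually_elim simp
    then show False using ultrafilter_nontrivial[OF assms] by simp
  qed
qed

lemma ultrafilter_imp:
  assumes "is_ultrafilter D"
  shows "(\<forall>\<^sub>F x in D. P x \<longrightarrow> P' x) \<longleftrightarrow> ((\<forall>\<^sub>F x in D. P x) \<longrightarrow> (\<forall>\<^sub>F x in D. P' x))"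
proof
  show "(\<forall>\<^sub>F x in D. P x \<longrightarrow> P' x) \<Longrightarrow> (\<forall>\<^sub>F x in D. P x) \<longrightarrow> (\<forall>\<^sub>F x in D. P' x)"
    by (blast intro: eventually_mp)
  assume "(\<forall>\<^sub>F x in D. P x) \<longrightarrow> (\<forall>\<^sub>F x in D. P' x)"
  then consider "\<forall>\<^sub>F x in D. \<not> P x" | "\<forall>\<^sub>F x in D. P' x" using ultrafilter_not[OF assms, of P] by blast
  then show "\<forall>\<^sub>F x in D. P x \<longrightarrow> P' x" by cases (auto elim: eventually_mono)
qed

lemma ultrafilter_ex: "is_ultrafilter D \<Longrightarrow> \<forall>\<^sub>F x in D. P x \<Longrightarrow> \<exists>x. P x"
  by (rule eventually_happens'[OF ultrafilter_nontrivial])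

text \<open>If every value were avoided almost everywhere, finitely many such conditions would
  combine to a contradiction. For \<open>D\<close> this gives each element of the ultrapower a
  standard branch; for an ultrafilter on the ultrapower it selects a limit branch.\<close>

lemma ultrafilter_finite_range:
  assumes "is_ultrafilter D" "finite K" "\<forall>\<^sub>F x in D. g x \<in> K"
  shows "\<exists>c\<in>K. \<forall>\<^sub>F x in D. g x = c"
proof (rule ccontr)
  assume "\<not> ?thesis"
  then have "\<forall>c\<in>K. \<forall>\<^sub>F x in D. g x \<noteq> c" by (simp add: ultrafilter_not[OF assms(1)])
  then have "\<forall>\<^sub>F x in D. \<forall>c\<in>K. g x \<noteq> c" using assms(2) by (simp add: eventually_ball_finite)
  with assms(3) have "\<forall>\<^sub>F x in D. False" by eventually_elim auto
  then show False using ultrafilter_nontrivial[OF assms(1)] by simp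
qed

text \<open>Zorn's lemma is applied to the families that contain \<open>\<S>\<close> and have the
  finite intersection property; a maximal one generates an ultrafilter.\<close>

lemma ultrafilter_extension:
  assumes fip: "\<And>\<F>. finite \<F> \<Longrightarrow> \<F> \<subseteq> \<S> \<Longrightarrow> \<Inter>\<F> \<noteq> {}"
  shows "\<exists>U. is_ultrafilter U \<and> (\<forall>S\<in>\<S>. \<forall>\<^sub>F x in U. x \<in> S)"
proof -
  define \<A> where "\<A> = {\<G>. \<S> \<subseteq> \<G> \<and> (\<forall>\<F>. finite \<F> \<longrightarrow> \<F> \<subseteq> \<G> \<longrightarrow> \<Inter>\<F> \<noteq> {})}"
  have "\<exists>M\<in>\<A>. \<forall>X\<in>\<A>. M \<subseteq> X \<longrightarrow> X = M"
  proof (rule subset_Zorn_nonempty)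
    show "\<A> \<noteq> {}" using fip by (auto simp: \<A>_def)
    fix \<C> assume \<C>: "\<C> \<noteq> {}" "subset.chain \<A> \<C>"
    have "\<Inter>\<F> \<noteq> {}" if fin: "finite \<F>" "\<F> \<subseteq> \<Union>\<C>" for \<F>
    proof -
      obtain \<G> where "\<G> \<in> \<C>" "\<F> \<subseteq> \<G>"
        using finite_subset_Union_chain[OF fin \<C>] by blast
      then show ?thesis using \<C> fin by (auto simp: subset.chain_def \<A>_def)
    qed
    moreover obtain \<G> where "\<G> \<in> \<C>" "\<S> \<subseteq> \<G>"
      using \<C> by (auto simp: \<A>_def subset.chain_def)
    ultimately show "\<Union>\<C> \<in> \<A>" by (auto simp: \<A>_def)
  qed
  then obtain M where M: "M \<in> \<A>" and max: "\<And>X. X \<in> \<A> \<Longrightarrow> M \<subseteq> X \<Longrightarrow> X = M" by blast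
  define U where "U = (INF S\<in>M. principal S)"
  have ev: "(\<forall>\<^sub>F x in U. P x) \<longleftrightarrow> (\<exists>\<F>\<subseteq>M. finite \<F> \<and> (\<forall>x\<in>\<Inter>\<F>. P x))" for P
  proof -
    have fin: "eventually P (INF S\<in>\<F>. principal S) \<longleftrightarrow> (\<forall>x\<in>\<Inter>\<F>. P x)" if "finite \<F>" for \<F>
      using INF_principal_finite[OF that, of "\<lambda>S. S"] by (simp add: eventually_principal)
    have "(\<forall>\<^sub>F x in U. P x) \<longleftrightarrow> (\<exists>\<F>\<subseteq>M. finite \<F> \<and> eventually P (INF S\<in>\<F>. principal S))"
      unfolding U_def by (rule eventually_INF)
    also have "\<dots> \<longleftrightarrow> (\<exists>\<F>\<subseteq>M. finite \<F> \<and> (\<forall>x\<in>\<Inter>\<F>. P x))"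
      by (rule iff_exI) (use fin in blast)
    finally show ?thesis .
  qed
  have fip_M: "\<Inter>\<F> \<noteq> {}" if "finite \<F>" "\<F> \<subseteq> M" for \<F>
    using M that unfolding \<A>_def by blast
  have "U \<noteq> bot"
  proof
    assume "U = bot"
    then have "\<forall>\<^sub>F x in U. False" by simp
    then obtain \<F> where "\<F> \<subseteq> M" "finite \<F>" "\<forall>x\<in>\<Inter>\<F>. False" using ev[of "\<lambda>_. False"] by blast
    then show False using fip_M[of \<F>] by blast
  qed
  have ultra: "(\<forall>\<^sub>F x in U. P x) \<or> (\<forall>\<^sub>F x in U. \<not> P x)" for P
  proof (cases "Collect P \<in> M")
    case True
    then have "\<forall>\<^sub>F x in U. P x" unfolding ev by (intro exI[of _ "{Collect P}"]) auto
    then show ?thesis ..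
  next
    case False
    \<comment> \<open>By maximality, finitely many members of \<open>M\<close> have no common point
      in \<open>Collect P\<close>, so their intersection lies in the complement.\<close>
    then have "insert (Collect P) M \<notin> \<A>" using max[of "insert (Collect P) M"] by blast
    moreover have "\<S> \<subseteq> insert (Collect P) M" using M by (auto simp: \<A>_def)
    ultimately obtain \<F> where \<F>: "finite \<F>" "\<F> \<subseteq> insert (Collect P) M" "\<Inter>\<F> = {}"
      unfolding \<A>_def mem_Collect_eq by meson
    have "\<forall>x\<in>\<Inter>(\<F> - {Collect P}). \<not> P x" using \<F>(3) by blast
    then have "\<forall>\<^sub>F x in U. \<not> P x"
      unfolding ev using \<F> by (intro exI[of _ "\<F> - {Collect P}"]) auto
    then show ?thesis ..
  qed
  have mem: "\<forall>\<^sub>F x in U. x \<in> S" if "S \<in> \<S>" for S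
    unfolding ev using that M by (intro exI[of _ "{S}"]) (auto simp: \<A>_def)
  show ?thesis unfolding is_ultrafilter_def
    by (intro exI[of _ U] conjI allI ballI \<open>U \<noteq> bot\<close> ultra mem)
qed

section \<open>Semantics\<close>

lemma sat_cong: "(\<And>x. x \<in> free_vars p \<Longrightarrow> v x = w x) \<Longrightarrow> sat M v p \<longleftrightarrow> sat M w p"
proof (induction p arbitrary: v w)
  case (Rel r xs)
  then have "map v xs = map w xs" by (simp cong: map_cong)
  then show ?case by (simp del: map_eq_conv)
next
  case (Imp p q)
  have "sat M v p = sat M w p" by (rule Imp.IH) (simp add: Imp.prems)
  moreover have "sat M v q = sat M w q" by (rule Imp.IH) (simp add: Imp.prems)
  ultimately show ?case by simp
next
  case (All x p)
  have "sat M (v(x := a)) p = sat M (w(x := a)) p" for a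
    by (rule All.IH) (simp add: All.prems)
  then show ?case by simp
qed auto

lemma sat_simps [simp]:
  "sat M v (Neg p) \<longleftrightarrow> \<not> sat M v p"
  "sat M v (And p q) \<longleftrightarrow> sat M v p \<and> sat M v q"
  "sat M v (Or p q) \<longleftrightarrow> sat M v p \<or> sat M v q"
  "sat M v (Iff p q) \<longleftrightarrow> (sat M v p \<longleftrightarrow> sat M v q)"
  by (auto simp: Neg_def And_def Or_def Iff_def)

lemma sat_Ands [simp]: "sat M v (Ands ps) \<longleftrightarrow> (\<forall>p\<in>set ps. sat M v p)"
proof -
  have "sat M v (foldr And ps (Neg Bot)) \<longleftrightarrow> (\<forall>p\<in>set ps. sat M v p)" by (induction ps) auto
  then show ?thesis by (simp add: Ands_def)
qed

lemma sat_Ors [simp]: "sat M v (Ors ps) \<longleftrightarrow> (\<exists>p\<in>set ps. sat M v p)"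
proof -
  have "sat M v (foldr Or ps Bot) \<longleftrightarrow> (\<exists>p\<in>set ps. sat M v p)" by (induction ps) auto
  then show ?thesis by (simp add: Ors_def)
qed

lemma is_fm_Neg [simp]: "is_fm L (Neg p) \<longleftrightarrow> is_fm L p"
  by (simp add: Neg_def)

lemma is_fm_Ands: "(\<And>p. p \<in> set ps \<Longrightarrow> is_fm L p) \<Longrightarrow> is_fm L (Ands ps)"
proof -
  assume "\<And>p. p \<in> set ps \<Longrightarrow> is_fm L p"
  then have "is_fm L (foldr And ps (Neg Bot))" by (induction ps) (auto simp: And_def)
  then show ?thesis by (simp add: Ands_def)
qed

text \<open>Ranging over all assignments into the carrier makes outer universal quantifiers
  irrelevant, so that the axioms can be handled without their prefix \<open>Alls\<close> or
  \<open>All\<close>.\<close>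

definition valid :: "('r, 'a) struct \<Rightarrow> 'r fm \<Rightarrow> bool" where
  "valid M p \<longleftrightarrow> (\<forall>v\<in>UNIV \<rightarrow> carrier M. sat M v p)"

lemma valid_All: "valid M (All x p) \<longleftrightarrow> valid M p"
proof
  assume A: "valid M (All x p)"
  show "valid M p" unfolding valid_def
  proof
    fix v :: "nat \<Rightarrow> _" assume v: "v \<in> UNIV \<rightarrow> carrier M"
    then have "\<forall>a\<in>carrier M. sat M (v(x := a)) p" using A by (auto simp: valid_def)
    with v have "sat M (v(x := v x)) p" by blast
    then show "sat M v p" by simp
  qed
next
  show "valid M p \<Longrightarrow> valid M (All x p)" by (auto simp: valid_def Pi_iff)
qed

lemma valid_Alls: "valid M (Alls n p) \<longleftrightarrow> valid M p"
proof -
  have "valid M (foldr All xs p) \<longleftrightarrow> valid M p" for xs by (induction xs) (auto simp: valid_All)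
  then show ?thesis by (simp add: Alls_def)
qed

lemma models_alt: "models L M T \<longleftrightarrow> is_struct L M \<and> (\<forall>p\<in>T. valid M p)"
  by (auto simp: models_def valid_def)

lemma embedding_atomic:
  assumes "is_embedding L e M N" "v \<in> UNIV \<rightarrow> carrier M"
  shows "sat M v (Eq x y) \<longleftrightarrow> sat N (e \<circ> v) (Eq x y)"
    "is_fm L (Rel r xs) \<Longrightarrow> sat M v (Rel r xs) \<longleftrightarrow> sat N (e \<circ> v) (Rel r xs)"
proof -
  have v: "v x \<in> carrier M" for x using assms(2) by auto
  show "sat M v (Eq x y) \<longleftrightarrow> sat N (e \<circ> v) (Eq x y)"
    using assms(1) v inj_on_eq_iff[of e "carrier M" "v x" "v y"] unfolding is_embedding_def by simp
  show "sat M v (Rel r xs) \<longleftrightarrow> sat N (e \<circ> v) (Rel r xs)" if "is_fm L (Rel r xs)"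
  proof -
    have "map v xs \<in> tuples (length xs) (carrier M)" using v by (auto simp: tuples_def)
    then have "map v xs \<in> interp M r \<longleftrightarrow> map e (map v xs) \<in> interp N r"
      using assms(1) that unfolding is_embedding_def by simp
    then show ?thesis by simp
  qed
qed

lemma embedding_comp:
  assumes "is_embedding L e A B" "is_embedding L e' B C"
  shows "is_embedding L (e' \<circ> e) A C"
  unfolding is_embedding_def
proof (intro conjI allI impI ballI)
  have e: "e ` carrier A \<subseteq> carrier B" using assms(1) by (auto simp: is_embedding_def)
  then show "e' \<circ> e \<in> carrier A \<rightarrow> carrier C" using assms(2) unfolding is_embedding_def by fastforce
  show "inj_on (e' \<circ> e) (carrier A)"
    using assms e by (intro comp_inj_on) (auto simp: is_embedding_def intro: inj_on_subset)
  fix r n xs assume r: "L r = Some n" and xs: "xs \<in> tuples n (carrier A)"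
  then have "map e xs \<in> tuples n (carrier B)" using e by (auto simp: tuples_def)
  then have "map e xs \<in> interp B r \<longleftrightarrow> map e' (map e xs) \<in> interp C r"
    using assms(2) r unfolding is_embedding_def by blast
  moreover have "xs \<in> interp A r \<longleftrightarrow> map e xs \<in> interp B r"
    using assms(1) r xs unfolding is_embedding_def by blast
  ultimately show "xs \<in> interp A r \<longleftrightarrow> map (e' \<circ> e) xs \<in> interp C r" by simp
qed

section \<open>Representatives in ultrapowers and Los's theorem\<close>

definition cls :: "'i filter \<Rightarrow> 'a set \<Rightarrow> ('i \<Rightarrow> 'a) \<Rightarrow> ('i \<Rightarrow> 'a) set" where
  "cls D C f = {g. g \<in> UNIV \<rightarrow> C \<and> (\<forall>\<^sub>F i in D. f i = g i)}"

lemma upower_set_cls: "upower_set D C = cls D C ` (UNIV \<rightarrow> C)"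
  unfolding upower_set_def quotient_def cls_def upower_rel_def by auto

lemma cls_self: "f \<in> UNIV \<rightarrow> C \<Longrightarrow> f \<in> cls D C f"
  by (simp add: cls_def)

lemma cls_in: "f \<in> UNIV \<rightarrow> C \<Longrightarrow> cls D C f \<in> upower_set D C"
  by (simp add: upower_set_cls)

lemma cls_eq_iff:
  assumes "f \<in> UNIV \<rightarrow> C" "g \<in> UNIV \<rightarrow> C"
  shows "cls D C f = cls D C g \<longleftrightarrow> (\<forall>\<^sub>F i in D. f i = g i)"
proof
  assume "cls D C f = cls D C g"
  then show "\<forall>\<^sub>F i in D. f i = g i" using cls_self[OF assms(2)] by (auto simp: cls_def)
next
  assume A: "\<forall>\<^sub>F i in D. f i = g i"
  have "(\<forall>\<^sub>F i in D. f i = h i) \<longleftrightarrow> (\<forall>\<^sub>F i in D. g i = h i)" for h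
    by (rule eventually_cong[OF A]) simp
  then show "cls D C f = cls D C g" by (simp add: cls_def)
qed

text \<open>Fixing a representative of each class lets an element of the ultrapower, or a finite set
  of them, be evaluated at every index.\<close>

definition rep :: "('i \<Rightarrow> 'a) set \<Rightarrow> 'i \<Rightarrow> 'a" where
  "rep c = (SOME f. f \<in> c)"

lemma rep:
  assumes "c \<in> upower_set D C"
  shows "rep c \<in> UNIV \<rightarrow> C" "cls D C (rep c) = c"
proof -
  obtain f where f: "f \<in> UNIV \<rightarrow> C" "c = cls D C f" using assms by (auto simp: upower_set_cls)
  then have "rep c \<in> c" unfolding rep_def by (metis cls_self someI)
  then have r: "rep c \<in> UNIV \<rightarrow> C" "\<forall>\<^sub>F i in D. f i = rep c i" using f by (auto simp: cls_def)
  then show "rep c \<in> UNIV \<rightarrow> C" "cls D C (rep c) = c"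
    using f cls_eq_iff[OF f(1) r(1)] by auto
qed

lemma rep_eq_iff:
  assumes "c \<in> upower_set D C" "d \<in> upower_set D C"
  shows "c = d \<longleftrightarrow> (\<forall>\<^sub>F i in D. rep c i = rep d i)"
  using cls_eq_iff[of "rep c" C "rep d" D] rep[OF assms(1)] rep[OF assms(2)] by metis

lemma internal_set_cls:
  assumes "f \<in> UNIV \<rightarrow> C"
  shows "cls D C f \<in> internal_set D C P \<longleftrightarrow> (\<forall>\<^sub>F i in D. f i \<in> P i)"
proof
  assume "cls D C f \<in> internal_set D C P"
  then obtain g where "\<forall>\<^sub>F i in D. f i = g i" "\<forall>\<^sub>F i in D. g i \<in> P i"
    by (auto simp: internal_set_def cls_def)
  then show "\<forall>\<^sub>F i in D. f i \<in> P i" by eventually_elim auto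
next
  show "\<forall>\<^sub>F i in D. f i \<in> P i \<Longrightarrow> cls D C f \<in> internal_set D C P"
    using assms cls_self[OF assms] cls_in[OF assms] by (auto simp: internal_set_def)
qed

text \<open>Induction on \<open>p\<close>: implication rests on the ultrafilter property, and a
  quantifier on choosing a counterexample at every index that has one.\<close>

lemma Los:
  assumes D: "is_ultrafilter D" and F: "\<And>x. F x \<in> UNIV \<rightarrow> carrier M"
  shows "sat (ultrapower D M) (\<lambda>x. cls D (carrier M) (F x)) p \<longleftrightarrow> (\<forall>\<^sub>F i in D. sat M (\<lambda>x. F x i) p)"
  using F
proof (induction p arbitrary: F)
  case Bot
  show ?case using ultrafilter_nontrivial[OF D] by simp
next
  case (Eq x y)
  then show ?case by (simp add: cls_eq_iff)
next
  case (Rel r xs)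
  define cs where "cs = map (\<lambda>x. cls D (carrier M) (F x)) xs"
  have "set cs \<subseteq> upower_set D (carrier M)" using Rel by (auto simp: cs_def intro: cls_in)
  moreover have "(\<exists>fs. list_all2 (\<in>) fs cs \<and> (\<forall>\<^sub>F i in D. map (\<lambda>f. f i) fs \<in> interp M r))
    \<longleftrightarrow> (\<forall>\<^sub>F i in D. map (\<lambda>x. F x i) xs \<in> interp M r)"
  proof
    assume "\<exists>fs. list_all2 (\<in>) fs cs \<and> (\<forall>\<^sub>F i in D. map (\<lambda>f. f i) fs \<in> interp M r)"
    then obtain fs where fs: "list_all2 (\<in>) fs cs" "\<forall>\<^sub>F i in D. map (\<lambda>f. f i) fs \<in> interp M r" by blast
    \<comment> \<open>The arguments are finitely many, so on one set of \<open>D\<close> the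
      representatives \<open>fs\<close> agree with the functions \<open>F\<close> at all of
      them.\<close>
    have "\<forall>\<^sub>F i in D. \<forall>j\<in>{..<length xs}. F (xs ! j) i = (fs ! j) i"
      using fs(1) by (intro eventually_ball_finite) (auto simp: cs_def list_all2_conv_all_nth cls_def)
    with fs(2) show "\<forall>\<^sub>F i in D. map (\<lambda>x. F x i) xs \<in> interp M r"
    proof eventually_elim
      case (elim i)
      have "map (\<lambda>f. f i) fs = map (\<lambda>x. F x i) xs"
        using elim(2) fs(1) by (auto simp: list_eq_iff_nth_eq list_all2_conv_all_nth cs_def)
      with elim(1) show ?case by simp
    qed
  next
    assume "\<forall>\<^sub>F i in D. map (\<lambda>x. F x i) xs \<in> interp M r"
    moreover have "list_all2 (\<in>) (map F xs) cs"
      using Rel by (auto simp: cs_def list_all2_conv_all_nth intro: cls_self)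
    ultimately show "\<exists>fs. list_all2 (\<in>) fs cs \<and> (\<forall>\<^sub>F i in D. map (\<lambda>f. f i) fs \<in> interp M r)"
      by (intro exI[of _ "map F xs"]) (simp add: comp_def)
  qed
  ultimately show ?case by (simp add: ultrapower_def cs_def)
next
  case (Imp p q)
  then show ?case by (simp add: ultrafilter_imp[OF D])
next
  case (All x p)
  let ?C = "carrier M" and ?N = "ultrapower D M"
  have upd: "(\<lambda>y. cls D ?C (F y))(x := cls D ?C f) = (\<lambda>y. cls D ?C ((F(x := f)) y))" for f by (rule ext) simp
  have upd': "(\<lambda>y. (F(x := f)) y i) = (\<lambda>y. F y i)(x := f i)" for f i by (rule ext) simp
  have "sat ?N (\<lambda>y. cls D ?C (F y)) (All x p)
    \<longleftrightarrow> (\<forall>f\<in>UNIV \<rightarrow> ?C. sat ?N ((\<lambda>y. cls D ?C (F y))(x := cls D ?C f)) p)"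
    by (simp add: ultrapower_def upower_set_cls)
  also have "\<dots> \<longleftrightarrow> (\<forall>f\<in>UNIV \<rightarrow> ?C. \<forall>\<^sub>F i in D. sat M (\<lambda>y. (F(x := f)) y i) p)"
    unfolding upd by (intro ball_cong refl All.IH) (use All.prems in auto)
  also have "\<dots> \<longleftrightarrow> (\<forall>f\<in>UNIV \<rightarrow> ?C. \<forall>\<^sub>F i in D. sat M ((\<lambda>y. F y i)(x := f i)) p)"
    by (simp only: upd')
  also have "\<dots> \<longleftrightarrow> (\<forall>\<^sub>F i in D. \<forall>a\<in>?C. sat M ((\<lambda>y. F y i)(x := a)) p)"
  proof
    assume A: "\<forall>f\<in>UNIV \<rightarrow> ?C. \<forall>\<^sub>F i in D. sat M ((\<lambda>y. F y i)(x := f i)) p"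
    \<comment> \<open>A Skolem function for the failure of \<open>p\<close>; where there is no
      counterexample, the value \<open>F x i\<close> keeps it inside the carrier.\<close>
    define f where "f i = (if \<exists>a\<in>?C. \<not> sat M ((\<lambda>y. F y i)(x := a)) p
      then SOME a. a \<in> ?C \<and> \<not> sat M ((\<lambda>y. F y i)(x := a)) p else F x i)" for i
    have f: "f i \<in> ?C \<and> (sat M ((\<lambda>y. F y i)(x := f i)) p \<longrightarrow> (\<forall>a\<in>?C. sat M ((\<lambda>y. F y i)(x := a)) p))" for i
    proof (cases "\<exists>a\<in>?C. \<not> sat M ((\<lambda>y. F y i)(x := a)) p")
      case True
      then have "f i \<in> ?C \<and> \<not> sat M ((\<lambda>y. F y i)(x := f i)) p"
        unfolding f_def by (simp only: if_True) (rule someI_ex, blast)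
      then show ?thesis by blast
    next
      case False
      then show ?thesis using All.prems by (auto simp: f_def)
    qed
    then have "\<forall>\<^sub>F i in D. sat M ((\<lambda>y. F y i)(x := f i)) p" using A by blast
    then show "\<forall>\<^sub>F i in D. \<forall>a\<in>?C. sat M ((\<lambda>y. F y i)(x := a)) p"
      by (rule eventually_mono) (use f in blast)
  next
    assume "\<forall>\<^sub>F i in D. \<forall>a\<in>?C. sat M ((\<lambda>y. F y i)(x := a)) p"
    then show "\<forall>f\<in>UNIV \<rightarrow> ?C. \<forall>\<^sub>F i in D. sat M ((\<lambda>y. F y i)(x := f i)) p"
      by (auto elim!: eventually_mono)
  qed
  finally show ?case by simp
qed

section \<open>Models of the universal theory\<close>

lemma distinct_permutation:
  assumes "distinct ys" "set xs = set ys" "length xs = length ys"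
  obtains \<sigma> where "\<sigma> permutes {..<length ys}" "permute_list \<sigma> ys = xs"
proof -
  have "distinct xs" using assms by (metis card_distinct distinct_card)
  then have "mset xs = mset ys" using assms by (simp add: set_eq_iff_mset_eq_distinct)
  then show ?thesis using mset_eq_permutation that by metis
qed

text \<open>Tuples with repeated entries are all edges and the remaining edges are closed under
  permutations, so only the set of entries matters. This is what allows hyperedges to be treated as
  sets.\<close>

lemma template_edges:
  assumes "is_template k H E"
  shows "xs \<in> E n \<longleftrightarrow> length xs = k \<and> set xs \<in> set ` E n"
proof -
  have "full_hypergraph k {..<H n} (E n)" using assms by (auto simp: is_template_def)
  then obtain E' where E': "E' \<subseteq> {xs \<in> tuples k {..<H n}. distinct xs}" "symmetric_tuples E'"
    "E n = E' \<union> {xs \<in> tuples k {..<H n}. card (set xs) < k}"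
    by (auto simp: full_hypergraph_def)
  show ?thesis
  proof
    show "xs \<in> E n \<Longrightarrow> length xs = k \<and> set xs \<in> set ` E n" using E' by (auto simp: tuples_def)
    assume A: "length xs = k \<and> set xs \<in> set ` E n"
    then obtain ys where ys: "ys \<in> E n" "set xs = set ys" by auto
    show "xs \<in> E n"
    proof (cases "card (set xs) < k")
      case True
      then show ?thesis using A ys E' by (auto simp: tuples_def)
    next
      case False
      then have "ys \<in> E'" using ys E' by auto
      then have "distinct ys" "length xs = length ys" using E' A by (auto simp: tuples_def)
      then obtain \<sigma> where "\<sigma> permutes {..<length ys}" "permute_list \<sigma> ys = xs"
        using distinct_permutation ys(2) by metis
      then show ?thesis using \<open>ys \<in> E'\<close> E' by (auto simp: symmetric_tuples_def)
    qed
  qed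
qed

text \<open>The template speaks of lists of exactly \<open>f n\<close> tuples; padding with the
  constant tuple of zeros, available as \<open>H n \<ge> f n > 0\<close>, turns this into a
  statement about finite sets of at most \<open>f n\<close> tuples.\<close>

lemma template_extension:
  assumes "is_template k H E"
  obtains f where "filterlim f at_top sequentially" "\<And>n. H n > 0"
    "\<And>n \<L>. finite \<L> \<Longrightarrow> \<L> \<subseteq> tuples (k - 1) {..<H n} \<Longrightarrow> card \<L> \<le> f n \<Longrightarrow>
      \<exists>s<H n. \<forall>xs\<in>\<L>. s # xs \<in> E n"
proof -
  obtain f :: "nat \<Rightarrow> nat" where f: "\<And>n. f n \<noteq> 0" "filterlim f at_top sequentially" "\<And>n. f n \<le> H n"
    and ext: "\<And>n iss. length iss = f n \<Longrightarrow> set iss \<subseteq> tuples (k - 1) {..<H n} \<Longrightarrow>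
      \<exists>s<H n. \<forall>l<f n. s # iss ! l \<in> E n"
    using assms unfolding is_template_def by blast
  have H: "H n > 0" for n using f(1,3)[of n] by linarith
  have "\<exists>s<H n. \<forall>xs\<in>\<L>. s # xs \<in> E n"
    if L: "finite \<L>" "\<L> \<subseteq> tuples (k - 1) {..<H n}" "card \<L> \<le> f n" for n \<L>
  proof -
    obtain ls where ls: "set ls = \<L>" "distinct ls" using L(1) finite_distinct_list by blast
    define iss where "iss = ls @ replicate (f n - length ls) (replicate (k - 1) 0)"
    have len: "length iss = f n" using L(3) ls distinct_card[OF ls(2)] by (simp add: iss_def)
    moreover have "set iss \<subseteq> tuples (k - 1) {..<H n}"
      using L(2) ls H[of n] by (auto simp: iss_def tuples_def split: if_splits)
    ultimately obtain s where s: "s < H n" "\<forall>l<f n. s # iss ! l \<in> E n" using ext by blast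
    have "s # xs \<in> E n" if "xs \<in> \<L>" for xs
    proof -
      have "xs \<in> set iss" using that ls by (simp add: iss_def)
      then show ?thesis using s(2) len by (metis in_set_conv_nth)
    qed
    then show ?thesis using s(1) by blast
  qed
  then show ?thesis by (rule that[OF f(2) H])
qed

text \<open>A model of \<^const>\<open>T0\<close> amounts to a branch \<open>br x\<close> of the tree for each element \<open>x\<close> together with
  a set \<open>r\<close> of \<open>k\<close>-element sets, each of which projects to an edge at every level of the template.\<close>

definition tree_graph ::
  "nat \<Rightarrow> (nat \<Rightarrow> nat) \<Rightarrow> (nat \<Rightarrow> nat list set) \<Rightarrow> 'a set \<Rightarrow> ('a \<Rightarrow> nat \<Rightarrow> nat) \<Rightarrow> 'a set set \<Rightarrow> bool" where
  "tree_graph k H E C br r \<longleftrightarrow> C \<noteq> {} \<and> (\<forall>x\<in>C. \<forall>n. br x n < H n) \<and>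
    (\<forall>S\<in>r. S \<subseteq> C \<and> finite S \<and> card S = k \<and> (\<forall>n. (\<lambda>x. br x n) ` S \<in> set ` E n))"

definition tg_struct :: "nat \<Rightarrow> 'a set \<Rightarrow> ('a \<Rightarrow> nat \<Rightarrow> nat) \<Rightarrow> 'a set set \<Rightarrow> (sym, 'a) struct" where
  "tg_struct k C br r = \<lparr> carrier = C,
     interp = (\<lambda>s. case s of R \<Rightarrow> {xs. length xs = k \<and> set xs \<in> r}
       | Q \<eta> \<Rightarrow> {[x] | x. x \<in> C \<and> (\<forall>n<length \<eta>. br x n = \<eta> ! n)}) \<rparr>"

text \<open>Agreement is demanded only on symbols of the language, because a model may interpret
  \<open>Q \<eta>\<close> arbitrarily when \<open>\<eta>\<close> is outside the tree.\<close>

definition presents ::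
  "nat \<Rightarrow> (nat \<Rightarrow> nat) \<Rightarrow> (sym, 'a) struct \<Rightarrow> ('a \<Rightarrow> nat \<Rightarrow> nat) \<Rightarrow> 'a set set \<Rightarrow> bool" where
  "presents k H M br r \<longleftrightarrow>
    (\<forall>s\<in>dom (T0_lang k H). interp M s = interp (tg_struct k (carrier M) br r) s)"

lemma presents_R:
  assumes "presents k H M br r"
  shows "xs \<in> interp M R \<longleftrightarrow> length xs = k \<and> set xs \<in> r"
proof -
  have "R \<in> dom (T0_lang k H)" by (simp add: dom_def)
  then show ?thesis using assms by (auto simp: presents_def tg_struct_def)
qed

lemma presents_Q:
  assumes "presents k H M br r" "\<eta> \<in> tree H"
  shows "xs \<in> interp M (Q \<eta>) \<longleftrightarrow> (\<exists>x\<in>carrier M. xs = [x] \<and> (\<forall>n<length \<eta>. br x n = \<eta> ! n))"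
proof -
  have "Q \<eta> \<in> dom (T0_lang k H)" using assms(2) by auto
  then show ?thesis using assms(1) by (auto simp: presents_def tg_struct_def)
qed

lemma presents_tg_struct: "presents k H (tg_struct k C br r) br r"
  by (simp add: presents_def tg_struct_def)

lemma carrier_tg_struct [simp]: "carrier (tg_struct k C br r) = C"
  by (simp add: tg_struct_def)

lemma tree_snoc: "\<eta> @ [i] \<in> tree H \<longleftrightarrow> \<eta> \<in> tree H \<and> i < H (length \<eta>)"
  by (auto simp: tree_def nth_append less_Suc_eq)

lemma map_nth_default: "length xs = k \<Longrightarrow> map (\<lambda>j. if j < k then xs ! j else d) [0..<k] = xs"
  by (auto simp: list_eq_iff_nth_eq)

lemma validI: "(\<And>v. (\<And>x. v x \<in> carrier M) \<Longrightarrow> sat M v p) \<Longrightarrow> valid M p"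
  by (auto simp: valid_def)

lemma eq_map_upt_iff: "xs = map f [0..<length xs] \<longleftrightarrow> (\<forall>n<length xs. f n = xs ! n)"
  by (subst list_eq_iff_nth_eq) auto

text \<open>This direction builds models of \<open>T0\<close> from combinatorial data; it will
  supply the one-point extension of a given model.\<close>

lemma T0_encode:
  assumes temp: "is_template k H E" and tg: "tree_graph k H E C br r"
  shows "models (T0_lang k H) (tg_struct k C br r) (T0 k H E)"
proof -
  let ?M = "tg_struct k C br r"
  note P = presents_R[OF presents_tg_struct] presents_Q[OF presents_tg_struct]
  have C: "C \<noteq> {}" "\<And>x n. x \<in> C \<Longrightarrow> br x n < H n" using tg by (auto simp: tree_graph_def)
  have r: "S \<subseteq> C" "finite S" "card S = k" "(\<lambda>x. br x n) ` S \<in> set ` E n" if "S \<in> r" for S n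
    using tg that unfolding tree_graph_def by blast+
  have str: "is_struct (T0_lang k H) ?M"
    unfolding is_struct_def
  proof (intro conjI allI impI)
    show "carrier ?M \<noteq> {}" using C by simp
    show "interp ?M s \<subseteq> tuples n (carrier ?M)" if "T0_lang k H s = Some n" for s n
    proof (cases s)
      case R
      have "set xs \<subseteq> C" if "set xs \<in> r" for xs using r(1)[OF that] .
      then show ?thesis using R that by (simp add: tuples_def tg_struct_def Collect_mono_iff)
    next
      case (Q \<eta>)
      then have "n = 1" using that by (simp split: if_splits)
      then show ?thesis using Q by (auto simp: tuples_def tg_struct_def)
    qed
  qed
  have "valid ?M p" if pT0: "p \<in> T0 k H E" for p
  proof -
    have v: "v x \<in> C" if "v \<in> UNIV \<rightarrow> carrier ?M" for v x using that by auto
    consider (perm) \<sigma> where "\<sigma> permutes {..<k}"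
        "p = Alls k (Imp (R_fm [0..<k]) (R_fm (permute_list \<sigma> [0..<k])))"
      | (dist) i j where "i < j" "j < k" "p = Alls k (Imp (R_fm [0..<k]) (Neg (Eq i j)))"
      | (root) "p = All 0 (Q_fm [] 0)"
      | (pre) \<eta> \<nu> where "\<nu> \<in> tree H" "prefix \<eta> \<nu>" "p = All 0 (Imp (Q_fm \<nu> 0) (Q_fm \<eta> 0))"
      | (part) \<eta> where "\<eta> \<in> tree H"
        "p = All 0 (Iff (Q_fm \<eta> 0) (Ors (map (\<lambda>i. Q_fm (\<eta> @ [i]) 0) [0..<H (length \<eta>)])))"
      | (disj) \<eta> i j where "\<eta> \<in> tree H" "i < j" "j < H (length \<eta>)"
        "p = All 0 (Neg (And (Q_fm (\<eta> @ [i]) 0) (Q_fm (\<eta> @ [j]) 0)))"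
      | (edge) \<eta>s n where "\<eta>s \<in> tuples k (tree H)" "\<forall>\<eta>\<in>set \<eta>s. n < length \<eta>" "map (\<lambda>\<eta>. \<eta> ! n) \<eta>s \<notin> E n"
        "p = Alls k (Imp (Ands (map (\<lambda>j. Q_fm (\<eta>s ! j) j) [0..<k])) (Neg (R_fm [0..<k])))"
      using pT0 unfolding T0_def Un_iff mem_Collect_eq singleton_iff
      by (elim disjE exE conjE) (rule that; assumption)+
    then show ?thesis
    proof cases
      case perm
      have S: "set (map v (permute_list \<sigma> [0..<k])) = set (map v [0..<k])" for v :: "nat \<Rightarrow> 'a"
        using perm(1) by simp
      show ?thesis unfolding perm(2) valid_Alls by (simp add: valid_def P S del: set_map)
    next
      case dist
      have D: "distinct (map v [0..<k])" if "set (map v [0..<k]) \<in> r" for v :: "nat \<Rightarrow> 'a"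
        using r(3)[OF that] by (intro card_distinct) simp
      have "v i \<noteq> v j" if "set (map v [0..<k]) \<in> r" for v :: "nat \<Rightarrow> 'a"
        using D[OF that] dist(1,2) inj_on_eq_iff[of v "{0..<k}" i j] by (simp add: distinct_map)
      then show ?thesis unfolding dist(3) valid_Alls by (simp add: valid_def P del: set_map)
    next
      case root
      then show ?thesis using v by (auto simp: valid_All P tree_def valid_def)
    next
      case pre
      have "\<eta> \<in> tree H" using pre by (auto simp: tree_def prefix_def nth_append split: if_splits)
      then show ?thesis using pre by (auto simp: valid_All P valid_def prefix_def nth_append)
    next
      case part
      have *: "[x] \<in> interp ?M (Q (\<eta> @ [i])) \<longleftrightarrow>
          [x] \<in> interp ?M (Q \<eta>) \<and> br x (length \<eta>) = i" if "i < H (length \<eta>)" for x i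
        using part(1) that by (auto simp: P tree_snoc nth_append less_Suc_eq)
      show ?thesis unfolding part(2) valid_All
      proof (rule validI)
        fix v :: "nat \<Rightarrow> 'a" assume "\<And>x. v x \<in> carrier ?M"
        then have v0: "v 0 \<in> C" by simp
        show "sat ?M v (Iff (Q_fm \<eta> 0) (Ors (map (\<lambda>i. Q_fm (\<eta> @ [i]) 0) [0..<H (length \<eta>)])))"
          using * C(2)[OF v0, of "length \<eta>"] by auto
      qed
    next
      case disj
      then have "\<eta> @ [i] \<in> tree H" "\<eta> @ [j] \<in> tree H" by (auto simp: tree_snoc)
      then show ?thesis unfolding disj(4) valid_All valid_def
        using disj(2) by (auto simp: P nth_append dest!: spec[of _ "length \<eta>"])
    next
      case edge
      show ?thesis unfolding edge(4) valid_Alls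
      proof (rule validI)
        fix v :: "nat \<Rightarrow> 'a"
        \<comment> \<open>If the tuple were related, its projection to level \<open>n\<close> would
          be an edge, but the predicates force this projection to be the forbidden tuple.\<close>
        have "set (map v [0..<k]) \<notin> r" if Q: "\<forall>j<k. [v j] \<in> interp ?M (Q (\<eta>s ! j))"
        proof
          assume "set (map v [0..<k]) \<in> r"
          from r(4)[OF this, of n] have "(\<lambda>x. br x n) ` set (map v [0..<k]) \<in> set ` E n" .
          then have "map (\<lambda>j. br (v j) n) [0..<k] \<in> E n"
            by (subst template_edges[OF temp]) (simp add: image_image)
          moreover have "br (v j) n = \<eta>s ! j ! n" if "j < k" for j
          proof -
            have "\<eta>s ! j \<in> tree H" "n < length (\<eta>s ! j)"
              using edge(1,2) that by (auto simp: tuples_def subset_iff)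
            then show ?thesis using Q that by (auto simp: P)
          qed
          then have "map (\<lambda>j. br (v j) n) [0..<k] = map (\<lambda>\<eta>. \<eta> ! n) \<eta>s"
            using edge(1) by (auto simp: tuples_def list_eq_iff_nth_eq)
          ultimately show False using edge(3) by simp
        qed
        then show "sat ?M v (Imp (Ands (map (\<lambda>j. Q_fm (\<eta>s ! j) j) [0..<k])) (Neg (R_fm [0..<k])))"
          by (auto simp: P)
      qed
    qed
  qed
  then show ?thesis using str by (simp add: models_alt)
qed

text \<open>The partition axioms place each element at one node of every level, and these nodes form
  a branch. Symmetry and distinctness allow \<open>R\<close> to be recovered from the sets of
  entries of its tuples.\<close>

lemma T0_decode:
  assumes temp: "is_template k H E" and M: "models (T0_lang k H) M (T0 k H E)"
  shows "\<exists>br r. tree_graph k H E (carrier M) br r \<and> presents k H M br r"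
proof -
  let ?C = "carrier M"
  have str: "is_struct (T0_lang k H) M" and val: "\<And>p. p \<in> T0 k H E \<Longrightarrow> valid M p"
    using M by (auto simp: models_alt)
  obtain d where d: "d \<in> ?C" using str by (auto simp: is_struct_def)
  have RC: "interp M R \<subseteq> tuples k ?C" and QC: "\<And>\<eta>. \<eta> \<in> tree H \<Longrightarrow> interp M (Q \<eta>) \<subseteq> tuples 1 ?C"
    using str unfolding is_struct_def by auto
  \<comment> \<open>An assignment that spells the tuple \<open>xs\<close> at the variables below
    \<open>k\<close>, for instantiating axioms with prefix \<open>Alls k\<close>; \<open>d\<close>
    fills the other variables.\<close>
  define w where "w xs j = (if j < k then xs ! j else d)" for xs j
  have w: "w xs \<in> UNIV \<rightarrow> ?C" "map (w xs) [0..<k] = xs" if "xs \<in> tuples k ?C" for xs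
    using that d map_nth_default[of xs k d] unfolding w_def[abs_def] by (auto simp: tuples_def subset_iff)
  have perm: "permute_list \<sigma> xs \<in> interp M R" if "xs \<in> interp M R" "\<sigma> permutes {..<k}" for \<sigma> xs
  proof -
    have xs: "xs \<in> tuples k ?C" using RC that by blast
    have "valid M (Alls k (Imp (R_fm [0..<k]) (R_fm (permute_list \<sigma> [0..<k]))))"
      using that(2) by (intro val) (auto simp: T0_def)
    then have "valid M (Imp (R_fm [0..<k]) (R_fm (permute_list \<sigma> [0..<k])))" by (simp only: valid_Alls)
    then have "sat M (w xs) (Imp (R_fm [0..<k]) (R_fm (permute_list \<sigma> [0..<k])))"
      using w(1)[OF xs] by (auto simp: valid_def)
    then show ?thesis using that w(2)[OF xs] by (simp add: permute_list_map[symmetric])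
  qed
  have dist: "distinct xs" if "xs \<in> interp M R" for xs
  proof -
    have xs: "xs \<in> tuples k ?C" using RC that by blast
    have "xs ! i \<noteq> xs ! j" if "i < j" "j < k" for i j
    proof -
      have "valid M (Alls k (Imp (R_fm [0..<k]) (Neg (Eq i j))))"
        using that by (intro val) (auto simp: T0_def)
      then have "valid M (Imp (R_fm [0..<k]) (Neg (Eq i j)))" by (simp only: valid_Alls)
      then have "sat M (w xs) (Imp (R_fm [0..<k]) (Neg (Eq i j)))"
        using w(1)[OF xs] by (auto simp: valid_def)
      then show ?thesis using \<open>xs \<in> interp M R\<close> w(2)[OF xs] that by (simp add: w_def)
    qed
    then show ?thesis using xs by (auto simp: distinct_conv_nth tuples_def) (metis nat_neq_iff)
  qed
  have root: "[x] \<in> interp M (Q [])" if "x \<in> ?C" for x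
  proof -
    have "valid M (All 0 (Q_fm [] 0))" by (intro val) (auto simp: T0_def)
    then show ?thesis using that by (auto simp: valid_def Pi_iff dest: spec[of _ "\<lambda>_. x"])
  qed
  have part: "[x] \<in> interp M (Q \<eta>) \<longleftrightarrow> (\<exists>i<H (length \<eta>). [x] \<in> interp M (Q (\<eta> @ [i])))"
    if "x \<in> ?C" "\<eta> \<in> tree H" for x \<eta>
  proof -
    have "valid M (All 0 (Iff (Q_fm \<eta> 0) (Ors (map (\<lambda>i. Q_fm (\<eta> @ [i]) 0) [0..<H (length \<eta>)]))))"
      using that by (intro val) (auto simp: T0_def)
    then have "sat M (\<lambda>_. x) (Iff (Q_fm \<eta> 0) (Ors (map (\<lambda>i. Q_fm (\<eta> @ [i]) 0) [0..<H (length \<eta>)])))"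
      unfolding valid_All using that by (auto simp: valid_def)
    then show ?thesis by auto
  qed
  have disj: "i = j" if "x \<in> ?C" "\<eta> \<in> tree H" "i < H (length \<eta>)" "j < H (length \<eta>)"
    "[x] \<in> interp M (Q (\<eta> @ [i]))" "[x] \<in> interp M (Q (\<eta> @ [j]))" for x \<eta> i j
  proof -
    have False if ij: "i < j" "j < H (length \<eta>)" and
      Q: "[x] \<in> interp M (Q (\<eta> @ [i]))" "[x] \<in> interp M (Q (\<eta> @ [j]))" for i j
    proof -
      have "valid M (All 0 (Neg (And (Q_fm (\<eta> @ [i]) 0) (Q_fm (\<eta> @ [j]) 0))))"
        using ij \<open>\<eta> \<in> tree H\<close> by (intro val) (auto simp: T0_def)
      then have "sat M (\<lambda>_. x) (Neg (And (Q_fm (\<eta> @ [i]) 0) (Q_fm (\<eta> @ [j]) 0)))"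
        unfolding valid_All using \<open>x \<in> ?C\<close> by (auto simp: valid_def)
      then show False using Q by auto
    qed
    then show ?thesis using that by (metis nat_neq_iff)
  qed
  \<comment> \<open>Existence at the next level holds because the children of a node cover it. For
    uniqueness, a node carrying \<open>x\<close> has a parent carrying \<open>x\<close>, which is
    known by induction, and siblings are disjoint.\<close>
  have ex1: "\<exists>!\<eta>. \<eta> \<in> tree H \<and> length \<eta> = m \<and> [x] \<in> interp M (Q \<eta>)" if x: "x \<in> ?C" for x m
  proof (induction m)
    case 0
    show ?case using root[OF x] by (auto simp: tree_def)
  next
    case (Suc m)
    then obtain \<eta> where \<eta>: "\<eta> \<in> tree H" "length \<eta> = m" "[x] \<in> interp M (Q \<eta>)"
      and uniq: "\<And>\<zeta>. \<zeta> \<in> tree H \<Longrightarrow> length \<zeta> = m \<Longrightarrow> [x] \<in> interp M (Q \<zeta>) \<Longrightarrow> \<zeta> = \<eta>" by blast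
    obtain i where i: "i < H (length \<eta>)" "[x] \<in> interp M (Q (\<eta> @ [i]))" using part[OF x] \<eta> by blast
    show ?case
    proof (rule ex1I[of _ "\<eta> @ [i]"])
      show "\<eta> @ [i] \<in> tree H \<and> length (\<eta> @ [i]) = Suc m \<and> [x] \<in> interp M (Q (\<eta> @ [i]))"
        using \<eta> i by (simp add: tree_snoc)
      fix \<zeta> assume \<zeta>: "\<zeta> \<in> tree H \<and> length \<zeta> = Suc m \<and> [x] \<in> interp M (Q \<zeta>)"
      then obtain \<xi> j where \<xi>: "\<zeta> = \<xi> @ [j]" "length \<xi> = m"
        by (metis append_butlast_last_id diff_Suc_1 length_butlast list.size(3) nat.distinct(1))
      then have j: "\<xi> \<in> tree H" "j < H (length \<xi>)" using \<zeta> by (auto simp: tree_snoc)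
      then have "[x] \<in> interp M (Q \<xi>)" using part[OF x] \<zeta> \<xi> by blast
      then have "\<xi> = \<eta>" using uniq j \<xi> by blast
      then show "\<zeta> = \<eta> @ [i]" using disj[OF x \<eta>(1)] i j \<zeta> \<xi> by blast
    qed
  qed
  define p where "p x m = (THE \<eta>. \<eta> \<in> tree H \<and> length \<eta> = m \<and> [x] \<in> interp M (Q \<eta>))" for x m
  have p: "p x m \<in> tree H" "length (p x m) = m" "[x] \<in> interp M (Q (p x m))" if "x \<in> ?C" for x m
    using theI'[OF ex1[OF that, of m]] by (simp_all add: p_def)
  have p_eq: "\<eta> = p x (length \<eta>)" if "x \<in> ?C" "\<eta> \<in> tree H" "[x] \<in> interp M (Q \<eta>)" for x \<eta>
    using ex1[OF that(1), of "length \<eta>"] p[OF that(1), of "length \<eta>"] that by blast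
  \<comment> \<open>The entry at position \<open>n\<close> first occurs in the node of length
    \<open>Suc n\<close>; \<open>p_br\<close> then shows that all these nodes are initial segments
    of one branch.\<close>
  define br where "br x n = p x (Suc n) ! n" for x n
  have p_br: "p x m = map (br x) [0..<m]" if x: "x \<in> ?C" for x m
  proof (induction m)
    case 0
    show ?case using p(2)[OF x, of 0] by simp
  next
    case (Suc m)
    obtain \<xi> j where \<xi>: "p x (Suc m) = \<xi> @ [j]" "length \<xi> = m"
      using p(2)[OF x, of "Suc m"]
      by (metis append_butlast_last_id diff_Suc_1 length_butlast list.size(3) nat.distinct(1))
    then have "\<xi> \<in> tree H" "j < H (length \<xi>)" using p(1)[OF x, of "Suc m"] by (auto simp: tree_snoc)
    then have "[x] \<in> interp M (Q \<xi>)" using part[OF x] p(3)[OF x, of "Suc m"] \<xi> by auto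
    then have "\<xi> = p x m" using p_eq[OF x \<open>\<xi> \<in> tree H\<close>] \<xi> by simp
    moreover have "br x m = j" using \<xi> by (simp add: br_def nth_append)
    ultimately show ?case using \<xi> Suc by simp
  qed
  define r where "r = set ` interp M R"
  have Riff: "xs \<in> interp M R \<longleftrightarrow> length xs = k \<and> set xs \<in> r" for xs
  proof
    show "xs \<in> interp M R \<Longrightarrow> length xs = k \<and> set xs \<in> r" using RC by (auto simp: r_def tuples_def)
    assume A: "length xs = k \<and> set xs \<in> r"
    then obtain ys where ys: "ys \<in> interp M R" "set xs = set ys" by (auto simp: r_def)
    then have "length xs = length ys" using A RC by (auto simp: tuples_def)
    then obtain \<sigma> where "\<sigma> permutes {..<length ys}" "permute_list \<sigma> ys = xs"
      using distinct_permutation dist ys by metis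
    then show "xs \<in> interp M R" using perm ys A \<open>length xs = length ys\<close> by metis
  qed
  have Qiff: "[x] \<in> interp M (Q \<eta>) \<longleftrightarrow> (\<forall>n<length \<eta>. br x n = \<eta> ! n)" if "x \<in> ?C" "\<eta> \<in> tree H" for x \<eta>
  proof -
    have "[x] \<in> interp M (Q \<eta>) \<longleftrightarrow> \<eta> = p x (length \<eta>)" using p_eq p that by metis
    also have "\<dots> \<longleftrightarrow> (\<forall>n<length \<eta>. br x n = \<eta> ! n)"
      by (simp only: p_br[OF that(1)] eq_map_upt_iff)
    finally show ?thesis .
  qed
  have brH: "br x n < H n" if "x \<in> ?C" for x n
  proof -
    have "\<forall>j<Suc n. p x (Suc n) ! j < H j" using p(1,2)[OF that, of "Suc n"] by (simp add: tree_def)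
    then show ?thesis by (simp add: br_def)
  qed
  have "(\<lambda>x. br x n) ` S \<in> set ` E n" if S: "S \<in> r" for S n
  proof -
    obtain xs where xs: "xs \<in> interp M R" "S = set xs" using S by (auto simp: r_def)
    then have tup: "xs \<in> tuples k ?C" using RC by blast
    define \<eta>s where "\<eta>s = map (\<lambda>x. p x (Suc n)) xs"
    have \<eta>s: "\<eta>s \<in> tuples k (tree H)" "\<forall>\<eta>\<in>set \<eta>s. n < length \<eta>"
      using tup p by (auto simp: \<eta>s_def tuples_def subset_iff)
    have eq: "map (\<lambda>\<eta>. \<eta> ! n) \<eta>s = map (\<lambda>x. br x n) xs" by (simp add: \<eta>s_def br_def)
    \<comment> \<open>Otherwise the axiom for the nodes of length \<open>Suc n\<close> that carry
      the entries of \<open>xs\<close> would forbid \<open>R\<close> on \<open>xs\<close>.\<close>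
    have "map (\<lambda>\<eta>. \<eta> ! n) \<eta>s \<in> E n"
    proof (rule ccontr)
      let ?p = "Imp (Ands (map (\<lambda>j. Q_fm (\<eta>s ! j) j) [0..<k])) (Neg (R_fm [0..<k]))"
      assume "map (\<lambda>\<eta>. \<eta> ! n) \<eta>s \<notin> E n"
      then have "Alls k ?p \<in> T0 k H E" unfolding T0_def using \<eta>s
        by (intro UnI2 CollectI exI[of _ \<eta>s] exI[of _ n]) simp
      then have "valid M (Alls k ?p)" by (rule val)
      then have "valid M ?p" by (simp only: valid_Alls)
      then have "sat M (w xs) ?p" using w(1)[OF tup] by (auto simp: valid_def)
      moreover have "[w xs j] \<in> interp M (Q (\<eta>s ! j))" if "j < k" for j
      proof -
        have "xs ! j \<in> ?C" using that tup by (auto simp: tuples_def)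
        then show ?thesis using p(3) that tup by (auto simp: w_def \<eta>s_def tuples_def)
      qed
      ultimately show False using xs w(2)[OF tup] by auto
    qed
    then show ?thesis unfolding eq using xs by (auto intro!: image_eqI[of _ set "map (\<lambda>x. br x n) xs"])
  qed
  moreover have "S \<subseteq> ?C \<and> finite S \<and> card S = k" if "S \<in> r" for S
    using that RC dist by (auto simp: r_def tuples_def distinct_card)
  ultimately have "tree_graph k H E ?C br r" using d brH by (auto simp: tree_graph_def)
  moreover have "presents k H M br r"
    unfolding presents_def
  proof
    fix s assume "s \<in> dom (T0_lang k H)"
    then show "interp M s = interp (tg_struct k ?C br r) s"
    proof (cases s)
      case R
      then show ?thesis using Riff by (auto simp: tg_struct_def)
    next
      case (Q \<eta>)
      then have "\<eta> \<in> tree H" using \<open>s \<in> _\<close> by (auto split: if_splits)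
      have sing: "\<exists>x\<in>?C. xs = [x]" if "xs \<in> interp M (Q \<eta>)" for xs
        using QC[OF \<open>\<eta> \<in> tree H\<close>] that by (auto simp: tuples_def length_Suc_conv)
      have "interp M (Q \<eta>) = {[x] | x. x \<in> ?C \<and> (\<forall>n<length \<eta>. br x n = \<eta> ! n)}"
        using sing Qiff[OF _ \<open>\<eta> \<in> tree H\<close>] by blast
      then show ?thesis using Q by (simp add: tg_struct_def)
    qed
  qed
  ultimately show ?thesis by blast
qed

section \<open>Existential closedness and quantifier elimination\<close>

definition literal :: "'r fm \<Rightarrow> bool" where
  "literal p \<longleftrightarrow> (\<exists>x y. p = Eq x y \<or> p = Neg (Eq x y)) \<or> (\<exists>s xs. p = Rel s xs \<or> p = Neg (Rel s xs))"

lemma embedding_literal: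
  assumes "is_embedding L e M N" "v \<in> UNIV \<rightarrow> carrier M" "literal p" "is_fm L p"
  shows "sat M v p \<longleftrightarrow> sat N (e \<circ> v) p"
  using assms(3,4) embedding_atomic[OF assms(1,2)] unfolding literal_def
  by (elim disjE exE) (simp_all only: is_fm_Neg sat_simps)

lemma embedding_id: "is_embedding L id M M"
  by (simp add: is_embedding_def)

text \<open>\<open>A\<close> embeds into a model \<open>N\<close> of \<open>T\<close>. As
  \<open>M\<close> itself is a model of \<open>T0\<close>, the composite embedding of
  \<open>M\<close> into \<open>N\<close> is elementary, so a solution in \<open>A\<close>, which
  persists in \<open>N\<close>, reflects down to \<open>M\<close>.\<close>

lemma existentially_closed:
  fixes M A :: "('r, 'u) struct"
  assumes mc: "is_model_completion TYPE('u) L U T" and M: "models L M T" and A: "models L A U"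
    and h: "is_embedding L h M A" and fin: "finite \<Phi>"
    and lit: "\<And>p. p \<in> \<Phi> \<Longrightarrow> literal p \<and> is_fm L p"
    and v: "v \<in> UNIV \<rightarrow> carrier M" and a: "a \<in> carrier A"
    and sat: "\<And>p. p \<in> \<Phi> \<Longrightarrow> sat A ((h \<circ> v)(0 := a)) p"
  shows "\<exists>b\<in>carrier M. \<forall>p\<in>\<Phi>. sat M (v(0 := b)) p"
proof -
  obtain N :: "('r, 'u) struct" and e where N: "models L N T" and e: "is_embedding L e A N"
    using mc A unfolding is_model_completion_def by metis
  have MU: "models L M U" using mc M unfolding is_model_completion_def by metis
  obtain ps where ps: "set ps = \<Phi>" using fin finite_list by blast
  define q where "q = Neg (All 0 (Neg (Ands ps)))"
  have q: "is_fm L q" unfolding q_def using lit ps by (auto intro: is_fm_Ands)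
  \<comment> \<open>Completeness of \<open>T\<close> together with the diagram of \<open>M\<close>,
    applied to the identity on \<open>M\<close> and to the composite embedding into
    \<open>N\<close>.\<close>
  have "sat M (id \<circ> v) q \<longleftrightarrow> sat N ((e \<circ> h) \<circ> v) q"
    using mc MU M embedding_id N embedding_comp[OF h e] q v unfolding is_model_completion_def by metis
  moreover have "sat N ((e \<circ> h) \<circ> v) q"
  proof -
    have w: "(h \<circ> v)(0 := a) \<in> UNIV \<rightarrow> carrier A"
      using h v a by (auto simp: is_embedding_def Pi_iff)
    have eq: "e \<circ> (h \<circ> v)(0 := a) = ((e \<circ> h) \<circ> v)(0 := e a)" by (rule ext) simp
    have "sat N (((e \<circ> h) \<circ> v)(0 := e a)) p" if "p \<in> \<Phi>" for p
      using embedding_literal[OF e w, of p] lit[OF that] sat[OF that] unfolding eq by blast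
    moreover have "e a \<in> carrier N" using e a by (auto simp: is_embedding_def)
    ultimately show ?thesis unfolding q_def using ps by auto
  qed
  ultimately show ?thesis unfolding q_def using ps by auto
qed

definition ksets :: "nat \<Rightarrow> 'a set \<Rightarrow> 'a set set" where
  "ksets n C = {S. S \<subseteq> C \<and> finite S \<and> card S = n}"

text \<open>\<open>X\<close> and \<open>Y\<close> are the \<open>(k - 1)\<close>-sets to which the
  new element must, or must not, be joined, \<open>Z\<close> is the set it must avoid and
  \<open>\<eta>\<close> gives the stem of its branch. Below \<open>m\<close> compatibility with
  \<open>X\<close> is assumed; from \<open>m\<close> on the branch is free, and the bound on
  \<open>card X\<close> lets the template supply it.\<close>

definition one_point_extensions ::
  "nat \<Rightarrow> (nat \<Rightarrow> nat) \<Rightarrow> (nat \<Rightarrow> nat list set) \<Rightarrow> (nat \<Rightarrow> nat) \<Rightarrow> 'a set \<Rightarrow> ('a \<Rightarrow> nat \<Rightarrow> nat) \<Rightarrow> 'a set set \<Rightarrow> bool"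
  where "one_point_extensions k H E f C br r \<longleftrightarrow>
    (\<forall>X Y Z m \<eta>. finite X \<and> finite Y \<and> finite Z \<and> X \<subseteq> ksets (k - 1) C \<and> Y \<subseteq> ksets (k - 1) C \<and>
       X \<inter> Y = {} \<and> Z \<subseteq> C \<and> (\<forall>n<m. \<eta> n < H n) \<and>
       (\<forall>S\<in>X. \<forall>n<m. insert (\<eta> n) ((\<lambda>x. br x n) ` S) \<in> set ` E n) \<and> (\<forall>n\<ge>m. card X \<le> f n) \<longrightarrow>
       (\<exists>b\<in>C - Z. (\<forall>n<m. br b n = \<eta> n) \<and> (\<forall>S\<in>X. insert b S \<in> r) \<and> (\<forall>S\<in>Y. insert b S \<notin> r)))"

text \<open>The required point is first added to a copy of \<open>M\<close>, giving a tree graph and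
  hence a model of \<open>T0\<close>; existential closedness then finds such a point in
  \<open>M\<close>.\<close>

lemma model_completion_extensions:
  fixes M :: "(sym, 'u) struct"
  assumes temp: "is_template k H E" and mc: "is_model_completion TYPE('u) (T0_lang k H) (T0 k H E) T"
    and M: "models (T0_lang k H) M T" and inf: "infinite (carrier M)"
    and pres: "presents k H M br r" and tg: "tree_graph k H E (carrier M) br r"
    and f: "\<And>n \<L>. finite \<L> \<Longrightarrow> \<L> \<subseteq> tuples (k - 1) {..<H n} \<Longrightarrow> card \<L> \<le> f n \<Longrightarrow>
      \<exists>s<H n. \<forall>xs\<in>\<L>. s # xs \<in> E n"
  shows "one_point_extensions k H E f (carrier M) br r"
  unfolding one_point_extensions_def
proof (intro allI impI; elim conjE)
  fix X Y Z m \<eta>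
  let ?C = "carrier M" and ?L = "T0_lang k H"
  assume fin: "finite X" "finite Y" "finite Z" and X: "X \<subseteq> ksets (k - 1) ?C" and Y: "Y \<subseteq> ksets (k - 1) ?C"
    and XY: "X \<inter> Y = {}" and Z: "Z \<subseteq> ?C" and \<eta>: "\<forall>n<m. \<eta> n < H n"
    and edge: "\<forall>S\<in>X. \<forall>n<m. insert (\<eta> n) ((\<lambda>x. br x n) ` S) \<in> set ` E n"
    and cardX: "\<forall>n\<ge>m. card X \<le> f n"
  have k: "k \<ge> 2" using temp by (simp add: is_template_def)
  have brH: "br x n < H n" if "x \<in> ?C" for x n using tg that by (simp add: tree_graph_def)
  have r: "S \<subseteq> ?C" "finite S" "card S = k" "(\<lambda>x. br x n) ` S \<in> set ` E n" if "S \<in> r" for S n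
    using tg that by (simp_all add: tree_graph_def)
  have XY_sets: "S \<subseteq> ?C" "finite S" "card S = k - 1" if "S \<in> X \<union> Y" for S
    using that X Y by (auto simp: ksets_def)
  \<comment> \<open>The carrier of \<open>M\<close> may exhaust the type, so \<open>M\<close> is
    copied along an injection \<open>h\<close> of the type into itself that misses the new point
    \<open>a\<close>.\<close>
  have "infinite (UNIV :: 'u set)" using inf by (meson finite_subset subset_UNIV)
  then obtain h :: "'u \<Rightarrow> 'u" and a where "bij_betw h UNIV (UNIV - {a})"
    by (meson infinite_imp_bij_betw)
  then have h: "inj h" "a \<notin> range h" by (auto simp: bij_betw_def)
  have ha: "h x \<noteq> a" for x using h(2) by auto
  have ha': "h ` S \<noteq> insert a T" for S T using ha by (metis imageE insertI1)
  have "\<exists>xs. set xs = S \<and> distinct xs" if "S \<in> X \<union> Y" for S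
    using finite_distinct_list XY_sets(2)[OF that] by blast
  then obtain l where l: "set (l S) = S" "distinct (l S)" if "S \<in> X \<union> Y" for S by metis
  have len: "length (l S) = k - 1" if "S \<in> X \<union> Y" for S
    using l[OF that] XY_sets[OF that] distinct_card by metis
  \<comment> \<open>Below \<open>m\<close> the prescribed entry \<open>\<eta> n\<close> works; from
    \<open>m\<close> on the extension property applies, since
    \<open>card X \<le> f n\<close>.\<close>
  have "\<exists>s<H n. \<forall>S\<in>X. insert s ((\<lambda>x. br x n) ` S) \<in> set ` E n" for n
  proof (cases "n < m")
    case True
    then show ?thesis using \<eta> edge by blast
  next
    case False
    let ?L = "(\<lambda>S. map (\<lambda>x. br x n) (l S)) ` X"
    have "?L \<subseteq> tuples (k - 1) {..<H n}"
    proof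
      fix xs assume "xs \<in> ?L"
      then obtain S where S: "S \<in> X \<union> Y" "xs = map (\<lambda>x. br x n) (l S)" by auto
      then show "xs \<in> tuples (k - 1) {..<H n}"
        using len[OF S(1)] l(1)[OF S(1)] XY_sets(1)[OF S(1)] brH by (auto simp: tuples_def)
    qed
    moreover have "card ?L \<le> f n"
      using card_image_le[OF fin(1)] cardX False by (meson le_trans not_less)
    ultimately obtain s where s: "s < H n" "\<forall>xs\<in>?L. s # xs \<in> E n" using f[of ?L n] fin by blast
    have "insert s ((\<lambda>x. br x n) ` S) \<in> set ` E n" if "S \<in> X" for S
    proof -
      have "set (s # map (\<lambda>x. br x n) (l S)) \<in> set ` E n" using s(2) that by blast
      then show ?thesis using l(1)[of S] that by simp
    qed
    then show ?thesis using s(1) by blast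
  qed
  then obtain s where s: "\<And>n. s n < H n" "\<And>n S. S \<in> X \<Longrightarrow> insert (s n) ((\<lambda>x. br x n) ` S) \<in> set ` E n"
    by metis
  define \<beta> where "\<beta> n = (if n < m then \<eta> n else s n)" for n
  have \<beta>H: "\<beta> n < H n" for n using \<eta> s by (simp add: \<beta>_def)
  have \<beta>E: "insert (\<beta> n) ((\<lambda>x. br x n) ` S) \<in> set ` E n" if "S \<in> X" for S n
    using edge s(2) that by (simp add: \<beta>_def)
  define C' where "C' = insert a (h ` ?C)"
  define br' where "br' y = (if y = a then \<beta> else br (inv h y))" for y
  \<comment> \<open>The only new hyperedges are those demanded by \<open>X\<close>; as
    \<open>Y\<close> is disjoint from \<open>X\<close>, its members are not joined to
    \<open>a\<close>.\<close>
  define r' where "r' = (`) h ` r \<union> (\<lambda>S. insert a (h ` S)) ` X"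
  define A where "A = tg_struct k C' br' r'"
  have br': "br' (h x) = br x" "br' a = \<beta>" for x using h ha by (simp_all add: br'_def)
  have "tree_graph k H E C' br' r'"
    unfolding tree_graph_def
  proof (intro conjI ballI allI)
    show "C' \<noteq> {}" by (simp add: C'_def)
    show "br' y n < H n" if "y \<in> C'" for y n using that brH \<beta>H by (auto simp: C'_def br')
    fix S assume "S \<in> r'"
    then consider S' where "S' \<in> r" "S = h ` S'" | S' where "S' \<in> X" "S = insert a (h ` S')"
      by (auto simp: r'_def)
    then have "S \<subseteq> C' \<and> finite S \<and> card S = k \<and> (\<forall>n. (\<lambda>x. br' x n) ` S \<in> set ` E n)"
    proof cases
      case 1
      have "card S = k" using 1 r h by (simp add: card_image inj_on_subset)
      moreover have "(\<lambda>x. br' x n) ` S = (\<lambda>x. br x n) ` S'" for n by (simp add: 1 image_image br')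
      moreover have "S \<subseteq> C'" using image_mono[OF r(1)[OF 1(1)], of h] 1(2) by (auto simp: C'_def)
      ultimately show ?thesis using 1 r(2,4) by simp
    next
      case 2
      have "card S = Suc (card (h ` S'))" using 2 XY_sets[of S'] ha by (auto simp: card_insert_if)
      also have "\<dots> = k" using 2 XY_sets[of S'] h k by (simp add: card_image inj_on_subset)
      finally have "card S = k" .
      moreover have "(\<lambda>x. br' x n) ` S = insert (\<beta> n) ((\<lambda>x. br x n) ` S')" for n
        by (simp add: 2 image_image br')
      ultimately show ?thesis using 2 XY_sets[of S'] \<beta>E[of S'] by (auto simp: C'_def)
    qed
    then show "S \<subseteq> C'" "finite S" "card S = k" "(\<lambda>x. br' x n) ` S \<in> set ` E n" for n by auto
  qed
  then have A: "models ?L A (T0 k H E)" unfolding A_def by (rule T0_encode[OF temp])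
  have presA: "presents k H A br' r'" unfolding A_def by (rule presents_tg_struct)
  have CA: "carrier A = C'" by (simp add: A_def)
  have hr: "h ` S \<in> r' \<longleftrightarrow> S \<in> r" for S
    using h(1) ha' by (auto simp: r'_def inj_image_eq_iff)
  have emb: "is_embedding ?L h M A"
    unfolding is_embedding_def
  proof (intro conjI allI impI ballI)
    show "h \<in> carrier M \<rightarrow> carrier A" by (auto simp: CA C'_def)
    show "inj_on h (carrier M)" using h(1) by (rule inj_on_subset) simp
    fix t n xs assume t: "?L t = Some n" and xs: "xs \<in> tuples n ?C"
    show "xs \<in> interp M t \<longleftrightarrow> map h xs \<in> interp A t"
    proof (cases t)
      case R
      then show ?thesis by (simp add: presents_R[OF pres] presents_R[OF presA] hr)
    next
      case (Q \<zeta>)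
      then have \<zeta>: "\<zeta> \<in> tree H" "n = 1" using t by (auto split: if_splits)
      then obtain x where x: "xs = [x]" "x \<in> ?C" using xs by (auto simp: tuples_def length_Suc_conv)
      then have "h x \<in> C'" by (simp add: C'_def)
      then show ?thesis using x
        by (simp add: Q presents_Q[OF pres \<zeta>(1)] presents_Q[OF presA \<zeta>(1)] CA br')
    qed
  qed
  define F where "F = Z \<union> \<Union>X \<union> \<Union>Y"
  have "finite F" using fin XY_sets by (auto simp: F_def)
  have FC: "F \<subseteq> ?C" using Z XY_sets by (auto simp: F_def)
  obtain fs where fs: "set fs = F" using \<open>finite F\<close> finite_list by blast
  obtain d where d: "d \<in> ?C" using inf by fastforce
  \<comment> \<open>The parameters are listed from variable \<open>1\<close> on, because variable
    \<open>0\<close> stands for the point to be found; \<open>d\<close> is a default value.\<close>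
  define v where "v j = (if 0 < j \<and> j \<le> length fs then fs ! (j - 1) else d)" for j
  have v: "v j \<in> ?C" for j
  proof (cases "0 < j \<and> j \<le> length fs")
    case True
    then have "fs ! (j - 1) \<in> set fs" by (intro nth_mem) linarith
    then show ?thesis using True FC fs by (auto simp: v_def)
  next
    case False
    then show ?thesis using d by (auto simp: v_def)
  qed
  have "\<exists>j>0. v j = x" if x: "x \<in> F" for x
  proof -
    obtain j where "j < length fs" "fs ! j = x" using x fs by (metis in_set_conv_nth)
    then show ?thesis by (intro exI[of _ "Suc j"]) (simp add: v_def)
  qed
  then obtain ix where ix: "ix x > 0" "v (ix x) = x" if "x \<in> F" for x by metis
  \<comment> \<open>All requirements become finitely many literals. The stem takes a single one,
    since the node of length \<open>m\<close> fixes every entry below \<open>m\<close>.\<close>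
  define \<Phi> where "\<Phi> = (\<lambda>z. Neg (Eq 0 (ix z))) ` Z \<union> {Q_fm (map \<eta> [0..<m]) 0} \<union>
    (\<lambda>S. R_fm (0 # map ix (l S))) ` X \<union> (\<lambda>S. Neg (R_fm (0 # map ix (l S)))) ` Y"
  have tree: "map \<eta> [0..<m] \<in> tree H" using \<eta> by (simp add: tree_def)
  have map_ix: "map (w(0 := c)) (map ix (l S)) = map (w \<circ> ix) (l S)"
    if "S \<in> X \<union> Y" for S c and w :: "nat \<Rightarrow> 'u"
  proof -
    have "ix x > 0" if "x \<in> set (l S)" for x using that l(1)[OF \<open>S \<in> X \<union> Y\<close>] \<open>S \<in> X \<union> Y\<close> ix(1)[of x]
      by (auto simp: F_def)
    then show ?thesis by fastforce
  qed
  have l_v: "map (v \<circ> ix) (l S) = l S" if "S \<in> X \<union> Y" for S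
  proof -
    have "v (ix x) = x" if "x \<in> set (l S)" for x using that l(1)[OF \<open>S \<in> X \<union> Y\<close>] \<open>S \<in> X \<union> Y\<close> ix(2)[of x]
      by (auto simp: F_def)
    then show ?thesis by (simp add: map_idI)
  qed
  \<comment> \<open>The general map \<open>g\<close> serves both structures: \<open>h\<close> for
    \<open>A\<close> and the identity for \<open>M\<close>.\<close>
  have satR: "sat N ((g \<circ> v)(0 := c)) (R_fm (0 # map ix (l S))) \<longleftrightarrow> c # map g (l S) \<in> interp N R"
    if "S \<in> X \<union> Y" for S c and N :: "(sym, 'u) struct" and g :: "'u \<Rightarrow> 'u"
  proof -
    have "map (g \<circ> v \<circ> ix) (l S) = map g (map (v \<circ> ix) (l S))" by simp
    then have "map ((g \<circ> v)(0 := c)) (map ix (l S)) = map g (l S)"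
      by (simp only: map_ix[OF that] l_v[OF that])
    then show ?thesis by (simp only: sat.simps list.map fun_upd_same)
  qed
  have "\<exists>b\<in>carrier M. \<forall>p\<in>\<Phi>. sat M (v(0 := b)) p"
  proof (rule existentially_closed[OF mc M A emb])
    show "finite \<Phi>" using fin by (simp add: \<Phi>_def)
    show "v \<in> UNIV \<rightarrow> carrier M" using v by simp
    show "a \<in> carrier A" by (simp add: CA C'_def)
    fix p assume "p \<in> \<Phi>"
    then consider z where "z \<in> Z" "p = Neg (Eq 0 (ix z))" | "p = Q_fm (map \<eta> [0..<m]) 0"
      | S where "S \<in> X" "p = R_fm (0 # map ix (l S))" | S where "S \<in> Y" "p = Neg (R_fm (0 # map ix (l S)))"
      unfolding \<Phi>_def by blast
    then have "literal p \<and> is_fm ?L p \<and> sat A ((h \<circ> v)(0 := a)) p"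
    proof cases
      case 1
      then have "ix z > 0" using ix(1)[of z] by (simp add: F_def)
      then have "sat A ((h \<circ> v)(0 := a)) p" using 1 ha[of "v (ix z)"] by simp
      moreover have "literal p" using 1 unfolding literal_def by blast
      ultimately show ?thesis using 1 by simp
    next
      case 2
      have "literal p" using 2 unfolding literal_def by blast
      then show ?thesis using 2 tree
        by (simp add: presents_Q[OF presA tree] CA C'_def br' \<beta>_def)
    next
      case 3
      have "literal p" using 3 unfolding literal_def by blast
      moreover have "insert a (h ` S) \<in> r'" using 3 by (simp add: r'_def)
      then have "a # map h (l S) \<in> interp A R"
        using 3 len[of S] l(1)[of S] k by (simp add: presents_R[OF presA])
      ultimately show ?thesis using 3 satR[of S] len[of S] k by simp
    next
      case 4
      have "literal p" using 4 unfolding literal_def by blast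
      moreover have "insert a (h ` S) \<notin> r'"
      proof
        assume "insert a (h ` S) \<in> r'"
        then obtain S' where S': "S' \<in> X" "insert a (h ` S) = insert a (h ` S')"
          using ha'[symmetric] by (auto simp: r'_def)
        moreover have "a \<notin> h ` S" "a \<notin> h ` S'" using ha by (metis imageE)+
        ultimately have "h ` S = h ` S'" by (simp add: insert_ident)
        then have "S = S'" using h(1) by (simp add: inj_image_eq_iff)
        then show False using S'(1) 4 XY by blast
      qed
      then have "a # map h (l S) \<notin> interp A R"
        using 4 len[of S] l(1)[of S] k by (simp add: presents_R[OF presA])
      ultimately show ?thesis using 4 satR[of S] len[of S] k by simp
    qed
    then show "literal p \<and> is_fm ?L p" "sat A ((h \<circ> v)(0 := a)) p" by auto
  qed
  then obtain b where b: "b \<in> ?C" "\<And>p. p \<in> \<Phi> \<Longrightarrow> sat M (v(0 := b)) p" by blast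
  have satR': "b # l S \<in> interp M R \<longleftrightarrow> insert b S \<in> r" if "S \<in> X \<union> Y" for S
    using len[OF that] l(1)[OF that] k by (simp add: presents_R[OF pres])
  have "b \<notin> Z"
  proof
    assume "b \<in> Z"
    then have "ix b > 0" "v (ix b) = b" using ix[of b] by (auto simp: F_def)
    moreover have "sat M (v(0 := b)) (Neg (Eq 0 (ix b)))"
      by (rule b(2)) (use \<open>b \<in> Z\<close> in \<open>simp add: \<Phi>_def\<close>)
    ultimately show False by simp
  qed
  moreover have "\<forall>n<m. br b n = \<eta> n"
  proof -
    have "sat M (v(0 := b)) (Q_fm (map \<eta> [0..<m]) 0)" by (rule b(2)) (simp add: \<Phi>_def)
    then show ?thesis by (simp add: presents_Q[OF pres tree])
  qed
  moreover have "insert b S \<in> r" if "S \<in> X" for S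
  proof -
    have "sat M (v(0 := b)) (R_fm (0 # map ix (l S)))" by (rule b(2)) (use that in \<open>simp add: \<Phi>_def\<close>)
    then show ?thesis using satR[of S M id b] satR'[of S] that by simp
  qed
  moreover have "insert b S \<notin> r" if "S \<in> Y" for S
  proof -
    have "sat M (v(0 := b)) (Neg (R_fm (0 # map ix (l S))))" by (rule b(2)) (use that in \<open>simp add: \<Phi>_def\<close>)
    then show ?thesis using satR[of S M id b] satR'[of S] that by simp
  qed
  ultimately show "\<exists>b\<in>?C - Z. (\<forall>n<m. br b n = \<eta> n) \<and> (\<forall>S\<in>X. insert b S \<in> r) \<and> (\<forall>S\<in>Y. insert b S \<notin> r)"
    using b(1) by blast
qed

section \<open>Back-and-forth and the elimination of quantifiers\<close>

definition same_type ::
  "('a \<Rightarrow> nat \<Rightarrow> nat) \<Rightarrow> 'a set set \<Rightarrow> nat \<Rightarrow> nat set \<Rightarrow> (nat \<Rightarrow> 'a) \<Rightarrow> (nat \<Rightarrow> 'a) \<Rightarrow> bool" where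
  "same_type br r m V v w \<longleftrightarrow> (\<forall>x\<in>V. \<forall>y\<in>V. v x = v y \<longleftrightarrow> w x = w y) \<and>
     (\<forall>x\<in>V. \<forall>n<m. br (v x) n = br (w x) n) \<and> (\<forall>S\<subseteq>V. v ` S \<in> r \<longleftrightarrow> w ` S \<in> r)"

lemma same_type_sym: "same_type br r m V v w \<Longrightarrow> same_type br r m V w v"
  by (simp add: same_type_def)

lemma same_type_mono:
  "same_type br r m V v w \<Longrightarrow> m' \<le> m \<Longrightarrow> V' \<subseteq> V \<Longrightarrow> same_type br r m' V' v w"
  unfolding same_type_def by (meson order_less_le_trans subset_iff subset_trans)

lemma finite_free_vars: "finite (free_vars p)"
  by (induction p) auto

text \<open>If \<open>a\<close> is already a value of \<open>v\<close> on \<open>V\<close>, the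
  corresponding value of \<open>w\<close> is taken. Otherwise a one-point extension over the values
  of \<open>w\<close> is used; its positive requirements come from subsets of \<open>V\<close>,
  whence the bound \<open>2 ^ card V\<close>.\<close>

lemma same_type_extend:
  assumes ope: "one_point_extensions k H E f C br r" and tg: "tree_graph k H E C br r" and k: "k \<ge> 1"
    and V: "finite V" and x: "x \<notin> V" and f: "\<And>n. n \<ge> m \<Longrightarrow> f n \<ge> 2 ^ card V"
    and st: "same_type br r m V v w" and vw: "\<And>y. v y \<in> C" "\<And>y. w y \<in> C" and a: "a \<in> C"
  shows "\<exists>b\<in>C. same_type br r m (insert x V) (v(x := a)) (w(x := b))"
proof -
  have eq: "v y = v z \<longleftrightarrow> w y = w z" if "y \<in> V" "z \<in> V" for y z using st that by (simp add: same_type_def)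
  have br: "br (v y) n = br (w y) n" if "y \<in> V" "n < m" for y n using st that by (simp add: same_type_def)
  have r: "v ` S \<in> r \<longleftrightarrow> w ` S \<in> r" if "S \<subseteq> V" for S using st that by (simp add: same_type_def)
  have upd: "(u(x := c)) ` S = u ` S" if "S \<subseteq> V" for u :: "nat \<Rightarrow> 'a" and c S
    using that x by (intro image_cong) auto
  have upd': "(u(x := c)) ` insert x S = insert c (u ` S)" if "S \<subseteq> V" for u :: "nat \<Rightarrow> 'a" and c S
    by (simp only: image_insert upd[OF that] fun_upd_same)
  have split: "(\<forall>S\<subseteq>insert x V. P S) \<longleftrightarrow> (\<forall>S\<subseteq>V. P S \<and> P (insert x S))" for P
  proof (intro iffI allI impI)
    fix S assume A: "\<forall>S\<subseteq>V. P S \<and> P (insert x S)" and S: "S \<subseteq> insert x V"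
    then have "P (S - {x}) \<and> P (insert x (S - {x}))" by blast
    then show "P S" by (cases "x \<in> S") (simp_all add: insert_absorb)
  qed blast
  have goal: "same_type br r m (insert x V) (v(x := a)) (w(x := b))"
    if "\<And>y. y \<in> V \<Longrightarrow> a = v y \<longleftrightarrow> b = w y" "\<And>n. n < m \<Longrightarrow> br a n = br b n"
      "\<And>S. S \<subseteq> V \<Longrightarrow> insert a (v ` S) \<in> r \<longleftrightarrow> insert b (w ` S) \<in> r" for b
  proof -
    have neq: "y \<noteq> x" if "y \<in> V" for y using that x by blast
    have "(v(x := a)) y = (v(x := a)) z \<longleftrightarrow> (w(x := b)) y = (w(x := b)) z"
      if "y \<in> insert x V" "z \<in> insert x V" for y z
      using that \<open>\<And>y. y \<in> V \<Longrightarrow> a = v y \<longleftrightarrow> b = w y\<close> eq neq by (metis fun_upd_apply insertE)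
    moreover have "br ((v(x := a)) y) n = br ((w(x := b)) y) n" if "y \<in> insert x V" "n < m" for y n
      using that \<open>\<And>n. n < m \<Longrightarrow> br a n = br b n\<close> br neq by auto
    moreover have "\<forall>S\<subseteq>insert x V. (v(x := a)) ` S \<in> r \<longleftrightarrow> (w(x := b)) ` S \<in> r"
      unfolding split
    proof (intro allI impI)
      fix S assume S: "S \<subseteq> V"
      show "((v(x := a)) ` S \<in> r \<longleftrightarrow> (w(x := b)) ` S \<in> r) \<and>
        ((v(x := a)) ` insert x S \<in> r \<longleftrightarrow> (w(x := b)) ` insert x S \<in> r)"
        by (simp only: upd[OF S] upd'[OF S] that(3)[OF S] r[OF S])
    qed
    ultimately show ?thesis unfolding same_type_def by blast
  qed
  show ?thesis
  proof (cases "a \<in> v ` V")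
    case True
    then obtain y where y: "y \<in> V" "a = v y" by blast
    have ins: "insert (v y) (v ` S) \<in> r \<longleftrightarrow> insert (w y) (w ` S) \<in> r" if "S \<subseteq> V" for S
      using r[of "insert y S"] y that by simp
    have "same_type br r m (insert x V) (v(x := a)) (w(x := w y))"
      by (rule goal) (simp_all add: y(2) eq[OF y(1)] br[OF y(1)] ins)
    then show ?thesis using vw(2) by blast
  next
    case False
    define X where "X = (\<lambda>S. w ` S) ` {S. S \<subseteq> V \<and> insert a (v ` S) \<in> r}"
    \<comment> \<open>Sets of size other than \<open>k - 1\<close> cannot form a hyperedge with a
      new point and are left out of \<open>Y\<close>. In \<open>X\<close> the size is automatic,
      because \<open>a\<close> is not a value of \<open>v\<close> on \<open>V\<close>.\<close>
    define Y where "Y = (\<lambda>S. w ` S) ` {S. S \<subseteq> V \<and> card (w ` S) = k - 1 \<and> insert a (v ` S) \<notin> r}"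
    \<comment> \<open>\<open>v\<close> and \<open>w\<close> identify the same variables, so the two
      kinds of images determine each other; this makes \<open>X\<close> and \<open>Y\<close>
      disjoint.\<close>
    have image_eq: "v ` S = v ` S' \<longleftrightarrow> w ` S = w ` S'" if "S \<subseteq> V" "S' \<subseteq> V" for S S'
    proof -
      have "v ` S \<subseteq> v ` S' \<longleftrightarrow> w ` S \<subseteq> w ` S'" if "S \<subseteq> V" "S' \<subseteq> V" for S S'
        using that eq unfolding image_subset_iff image_iff by (meson subsetD)
      then show ?thesis using that by (simp add: set_eq_subset)
    qed
    have card_eq: "card (v ` S) = card (w ` S)" if "S \<subseteq> V" for S
    proof -
      \<comment> \<open>The map sends \<open>v y\<close> to \<open>w y\<close>, by way of a chosen
        variable in \<open>S\<close> with value \<open>v y\<close>.\<close>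
      have "bij_betw (\<lambda>y. w (SOME z. z \<in> S \<and> v z = y)) (v ` S) (w ` S)"
      proof -
        have sm: "(SOME z. z \<in> S \<and> v z = v y) \<in> S \<and> v (SOME z. z \<in> S \<and> v z = v y) = v y" if "y \<in> S" for y
          by (rule someI_ex) (use that in blast)
        then have "w (SOME z. z \<in> S \<and> v z = v y) = w y" if "y \<in> S" for y
          using eq \<open>S \<subseteq> V\<close> that by (meson subsetD)
        then show ?thesis using eq \<open>S \<subseteq> V\<close> by (auto simp: bij_betw_def inj_on_def image_image)
      qed
      then show ?thesis by (rule bij_betw_same_card)
    qed
    have rcard: "card S = k" if "S \<in> r" for S using tg that by (simp add: tree_graph_def)
    have rE: "(\<lambda>x. br x n) ` S \<in> set ` E n" if "S \<in> r" for S n using tg that by (simp add: tree_graph_def)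
    have card_X: "card (w ` S) = k - 1" if "S \<subseteq> V" "insert a (v ` S) \<in> r" for S
    proof -
      have "finite S" using that V finite_subset by blast
      then have "card (insert a (v ` S)) = Suc (card (v ` S))"
        using False that by (intro card_insert_disjoint) auto
      then show ?thesis using rcard[OF that(2)] card_eq[OF that(1)] by simp
    qed
    have finS: "finite S" if "S \<subseteq> V" for S using that V finite_subset by blast
    have "finite X" "finite Y" unfolding X_def Y_def using V by auto
    moreover have "X \<subseteq> ksets (k - 1) C" "Y \<subseteq> ksets (k - 1) C"
      using card_X vw finS by (auto simp: X_def Y_def ksets_def)
    moreover have "X \<inter> Y = {}"
    proof (rule ccontr)
      assume "X \<inter> Y \<noteq> {}"
      then obtain S S' where "S \<subseteq> V" "S' \<subseteq> V" "w ` S = w ` S'" "insert a (v ` S) \<in> r" "insert a (v ` S') \<notin> r"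
        unfolding X_def Y_def by blast
      then show False using image_eq[of S S'] by simp
    qed
    moreover have "\<forall>n<m. br a n < H n" using tg a by (simp add: tree_graph_def)
    moreover have "\<forall>S\<in>X. \<forall>n<m. insert (br a n) ((\<lambda>x. br x n) ` S) \<in> set ` E n"
    proof (intro ballI allI impI)
      fix T n assume "T \<in> X" and n: "n < m"
      then obtain S where S: "T = w ` S" "S \<subseteq> V" "insert a (v ` S) \<in> r" by (auto simp: X_def)
      have "(\<lambda>y. br (w y) n) ` S = (\<lambda>y. br (v y) n) ` S"
        using br n S(2) by (intro image_cong) auto
      then have "insert (br a n) ((\<lambda>x. br x n) ` T) = (\<lambda>x. br x n) ` insert a (v ` S)"
        by (simp add: S(1) image_image)
      then show "insert (br a n) ((\<lambda>x. br x n) ` T) \<in> set ` E n" using rE[OF S(3)] by simp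
    qed
    moreover have "\<forall>n\<ge>m. card X \<le> f n"
    proof (intro allI impI)
      fix n assume "m \<le> n"
      have "card X \<le> card {S. S \<subseteq> V \<and> insert a (v ` S) \<in> r}"
        unfolding X_def by (rule card_image_le) (use V in auto)
      also have "\<dots> \<le> card (Pow V)" by (rule card_mono) (use V in auto)
      also have "\<dots> \<le> f n" using f[OF \<open>m \<le> n\<close>] V by (simp add: card_Pow)
      finally show "card X \<le> f n" .
    qed
    moreover have "finite (w ` V)" "w ` V \<subseteq> C" using V vw by auto
    ultimately have "\<exists>b\<in>C - w ` V. (\<forall>n<m. br b n = br a n) \<and> (\<forall>S\<in>X. insert b S \<in> r) \<and> (\<forall>S\<in>Y. insert b S \<notin> r)"
      using ope[unfolded one_point_extensions_def, rule_format, of X Y "w ` V" m "br a"] by blast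
    then obtain b where b: "b \<in> C" "b \<notin> w ` V" "\<forall>n<m. br b n = br a n"
      "\<forall>S\<in>X. insert b S \<in> r" "\<forall>S\<in>Y. insert b S \<notin> r" by blast
    have "insert a (v ` S) \<in> r \<longleftrightarrow> insert b (w ` S) \<in> r" if S: "S \<subseteq> V" for S
    proof
      show "insert a (v ` S) \<in> r \<Longrightarrow> insert b (w ` S) \<in> r" using b(4) S by (auto simp: X_def)
      assume B: "insert b (w ` S) \<in> r"
      have "card (insert b (w ` S)) = Suc (card (w ` S))"
        using b(2) S finS[OF S] by (intro card_insert_disjoint) auto
      then have "card (w ` S) = k - 1" using rcard[OF B] by simp
      then show "insert a (v ` S) \<in> r" using b(5) S B by (auto simp: Y_def)
    qed
    then have "same_type br r m (insert x V) (v(x := a)) (w(x := b))"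
      using goal[of b] False b(2,3) by (metis imageI)
    then show ?thesis using b(1) by blast
  qed
qed

text \<open>Induction on the formula. At a quantifier the level is raised until \<open>f\<close>
  stays at least the number of subsets of the free variables, so that the extension of assignments
  above applies.\<close>

lemma quantifier_elimination:
  assumes pres: "presents k H M br r" and tg: "tree_graph k H E (carrier M) br r" and k: "k \<ge> 1"
    and ope: "one_point_extensions k H E f (carrier M) br r" and f: "filterlim f at_top sequentially"
    and p: "is_fm (T0_lang k H) p"
  shows "\<exists>m. \<forall>v w. (\<forall>y. v y \<in> carrier M) \<and> (\<forall>y. w y \<in> carrier M) \<and> same_type br r m (free_vars p) v w \<longrightarrow>
    (sat M v p \<longleftrightarrow> sat M w p)"
  using p
proof (induction p)
  case Bot
  show ?case by simp
next
  case (Eq x y)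
  show ?case by (auto simp: same_type_def)
next
  case (Rel s xs)
  show ?case
  proof (cases s)
    case R
    then show ?thesis using Rel by (simp add: presents_R[OF pres] same_type_def)
  next
    case (Q \<eta>)
    then have \<eta>: "\<eta> \<in> tree H" "length xs = 1" using Rel by (auto split: if_splits)
    then obtain x where x: "xs = [x]" by (auto simp: length_Suc_conv)
    show ?thesis
      by (intro exI[of _ "length \<eta>"]) (simp add: Q x presents_Q[OF pres \<eta>(1)] same_type_def)
  qed
next
  case (Imp p q)
  then obtain m1 m2 where
    m1: "\<And>v w. (\<forall>y. v y \<in> carrier M) \<Longrightarrow> (\<forall>y. w y \<in> carrier M) \<Longrightarrow> same_type br r m1 (free_vars p) v w \<Longrightarrow>
      sat M v p \<longleftrightarrow> sat M w p" and
    m2: "\<And>v w. (\<forall>y. v y \<in> carrier M) \<Longrightarrow> (\<forall>y. w y \<in> carrier M) \<Longrightarrow> same_type br r m2 (free_vars q) v w \<Longrightarrow>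
      sat M v q \<longleftrightarrow> sat M w q"
    unfolding is_fm.simps by metis
  show ?case
  proof (intro exI[of _ "max m1 m2"] allI impI; elim conjE)
    fix v w assume A: "\<forall>y. v y \<in> carrier M" "\<forall>y. w y \<in> carrier M"
      "same_type br r (max m1 m2) (free_vars (Imp p q)) v w"
    have "same_type br r m1 (free_vars p) v w" "same_type br r m2 (free_vars q) v w"
      by (rule same_type_mono[OF A(3)]; simp)+
    then show "sat M v (Imp p q) \<longleftrightarrow> sat M w (Imp p q)" using m1 m2 A(1,2) by simp
  qed
next
  case (All x p)
  define V where "V = free_vars p - {x}"
  have V: "finite V" "x \<notin> V" "free_vars p \<subseteq> insert x V" using finite_free_vars by (auto simp: V_def)
  obtain m1 where
    m1: "\<And>v w. (\<forall>y. v y \<in> carrier M) \<Longrightarrow> (\<forall>y. w y \<in> carrier M) \<Longrightarrow> same_type br r m1 (free_vars p) v w \<Longrightarrow>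
      sat M v p \<longleftrightarrow> sat M w p"
    using All unfolding is_fm.simps by metis
  have "\<forall>\<^sub>F n in sequentially. f n \<ge> 2 ^ card V" using f by (simp add: filterlim_at_top)
  then obtain m2 where m2: "\<And>n. n \<ge> m2 \<Longrightarrow> f n \<ge> 2 ^ card V" by (auto simp: eventually_sequentially)
  \<comment> \<open>One implication suffices, as \<open>same_type\<close> is symmetric: an instance
    for \<open>w\<close> is matched by an instance for \<open>v\<close>.\<close>
  have one: "sat M w (All x p)"
    if A: "\<forall>y. v y \<in> carrier M" "\<forall>y. w y \<in> carrier M" "same_type br r (max m1 m2) V v w" "sat M v (All x p)" for v w
    unfolding sat.simps
  proof
    fix a assume a: "a \<in> carrier M"
    obtain b where b: "b \<in> carrier M" "same_type br r (max m1 m2) (insert x V) (w(x := a)) (v(x := b))"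
      using same_type_extend[OF ope tg k V(1,2) _ same_type_sym[OF A(3)] _ _ a] m2 A by auto
    have "same_type br r m1 (free_vars p) (w(x := a)) (v(x := b))"
      by (rule same_type_mono[OF b(2)]) (use V in auto)
    then have "sat M (w(x := a)) p \<longleftrightarrow> sat M (v(x := b)) p" by (rule m1[rotated 2]) (use A a b in auto)
    then show "sat M (w(x := a)) p" using A(4) b(1) by simp
  qed
  show ?case
  proof (intro exI[of _ "max m1 m2"] allI impI; elim conjE)
    fix v w assume A: "\<forall>y. v y \<in> carrier M" "\<forall>y. w y \<in> carrier M"
      "same_type br r (max m1 m2) (free_vars (All x p)) v w"
    then have "same_type br r (max m1 m2) V v w" by (simp add: V_def)
    then show "sat M v (All x p) \<longleftrightarrow> sat M w (All x p)"
      using one[OF A(1,2)] one[OF A(2,1)] same_type_sym by blast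
  qed
qed

section \<open>Realizing types\<close>

lemma nonstandard_gt:
  assumes "is_ultrafilter D"
  shows "is_nonstandard D n \<longleftrightarrow> (\<forall>m. \<forall>\<^sub>F i in D. m < n i)"
proof
  assume ns: "is_nonstandard D n"
  show "\<forall>m. \<forall>\<^sub>F i in D. m < n i"
  proof (rule ccontr)
    assume "\<not> (\<forall>m. \<forall>\<^sub>F i in D. m < n i)"
    then obtain m where "\<not> (\<forall>\<^sub>F i in D. m < n i)" by blast
    then have "\<forall>\<^sub>F i in D. n i \<in> {..m}" by (simp add: ultrafilter_not[OF assms] not_less)
    then show False using ultrafilter_finite_range[OF assms finite_atMost] ns
      by (auto simp: is_nonstandard_def)
  qed
next
  assume gt: "\<forall>m. \<forall>\<^sub>F i in D. m < n i"
  have "\<not> (\<forall>\<^sub>F i in D. n i = m)" for m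
    unfolding ultrafilter_not[OF assms] by (rule eventually_mono[OF gt[rule_format, of m]]) simp
  then show "is_nonstandard D n" by (simp add: is_nonstandard_def)
qed

text \<open>Counting the members of a regular family that contain \<open>i\<close> gives such an
  integer: the count is finite at every index, but exceeds \<open>m\<close> on the intersection of
  any \<open>m + 1\<close> members.\<close>

lemma regular_nonstandard:
  fixes D :: "'i filter"
  assumes D: "is_ultrafilter D" and "is_regular D" and inf: "infinite (UNIV :: 'i set)"
  shows "\<exists>N. is_nonstandard D N"
proof -
  obtain X :: "'i \<Rightarrow> 'i set" where X: "\<And>\<alpha>. \<forall>\<^sub>F i in D. i \<in> X \<alpha>" "\<And>i. finite {\<alpha>. i \<in> X \<alpha>}"
    using assms(2) unfolding is_regular_def by blast
  have "\<forall>\<^sub>F i in D. m < card {\<alpha>. i \<in> X \<alpha>}" for m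
  proof -
    obtain B :: "'i set" where B: "finite B" "card B = Suc m"
      using infinite_arbitrarily_large[OF inf] by blast
    then have "\<forall>\<^sub>F i in D. \<forall>\<alpha>\<in>B. i \<in> X \<alpha>" using X(1) by (intro eventually_ball_finite) auto
    then show ?thesis
    proof (rule eventually_mono)
      fix i assume "\<forall>\<alpha>\<in>B. i \<in> X \<alpha>"
      then have "card B \<le> card {\<alpha>. i \<in> X \<alpha>}" by (intro card_mono X(2)) auto
      then show "m < card {\<alpha>. i \<in> X \<alpha>}" using B(2) by simp
    qed
  qed
  then show ?thesis
    by (intro exI[of _ "\<lambda>i. card {\<alpha>. i \<in> X \<alpha>}"]) (simp add: nonstandard_gt[OF D])
qed

lemma csum_card_of_ordLeq:
  assumes "infinite B" "|A1| \<le>o |B|" "|A2| \<le>o |B|"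
  shows "|A1| +c |A2| \<le>o |B|"
  by (rule csum_cinfinite_bound) (use assms in \<open>auto simp: cinfinite_def Field_card_of card_of_card_order_on\<close>)

text \<open>An internal set containing the given nonstandard numbers but no standard one has a nonstandard
  least element.\<close>

lemma good_lower_bound:
  fixes D :: "'i filter" and G :: "('i \<Rightarrow> nat) set"
  assumes D: "is_ultrafilter D" and inf: "infinite (UNIV :: 'i set)" "infinite (UNIV :: 'u set)"
    and good: "good_for_random_graph TYPE('u) D" and G: "|G| \<le>o |UNIV :: 'i set|" "G \<noteq> {}"
    and ns: "\<And>g. g \<in> G \<Longrightarrow> is_nonstandard D g"
  shows "\<exists>m. is_nonstandard D m \<and> (\<forall>g\<in>G. \<forall>\<^sub>F i in D. m i \<le> g i)"
proof -
  \<comment> \<open>Goodness is assumed for subsets of \<open>'u\<close>, so the natural numbers are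
    copied into that type.\<close>
  obtain \<iota> :: "nat \<Rightarrow> 'u" where \<iota>: "inj \<iota>" using infinite_countable_subset[OF inf(2)] by blast
  define C where "C = range \<iota>"
  define A where "A = (\<lambda>g. cls D C (\<lambda>i. \<iota> (g i))) ` G"
  define B where "B = range (\<lambda>n. cls D C (\<lambda>i. \<iota> n))"
  have in_C: "(\<lambda>i. \<iota> (g i)) \<in> UNIV \<rightarrow> C" for g :: "'i \<Rightarrow> nat" by (simp add: C_def)
  have "infinite C" using \<iota> by (simp add: C_def finite_image_iff)
  moreover have "A \<subseteq> upower_set D C" "B \<subseteq> upower_set D C"
    using in_C by (auto simp: A_def B_def intro!: cls_in in_C)
  moreover have "|A| +c |B| \<le>o |UNIV :: 'i set|"
  proof (rule csum_card_of_ordLeq[OF inf(1)])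
    show "|A| \<le>o |UNIV :: 'i set|" unfolding A_def by (rule ordLeq_transitive[OF card_of_image G(1)])
    have "|UNIV :: nat set| \<le>o |UNIV :: 'i set|" using inf(1) by (simp add: infinite_iff_card_of_nat)
    then show "|B| \<le>o |UNIV :: 'i set|" unfolding B_def by (rule ordLeq_transitive[OF card_of_image])
  qed
  moreover have "A \<inter> B = {}"
  proof -
    have "cls D C (\<lambda>i. \<iota> (g i)) \<noteq> cls D C (\<lambda>i. \<iota> n)" if "g \<in> G" for g n
      using ns[OF that] in_C[of "\<lambda>_. n"] in_C[of g] \<iota>
      by (simp add: cls_eq_iff is_nonstandard_def inj_eq)
    then show ?thesis by (auto simp: A_def B_def)
  qed
  ultimately obtain P where P: "A \<subseteq> internal_set D C P" "B \<inter> internal_set D C P = {}"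
    using good unfolding good_for_random_graph_def by meson
  have PA: "\<forall>\<^sub>F i in D. \<iota> (g i) \<in> P i" if "g \<in> G" for g
    using P(1) that internal_set_cls[OF in_C[of g]] by (auto simp: A_def)
  have PB: "\<not> (\<forall>\<^sub>F i in D. \<iota> n \<in> P i)" for n
    using P(2) internal_set_cls[OF in_C[of "\<lambda>_. n"]] by (auto simp: B_def)
  \<comment> \<open>If this least element were almost everywhere a fixed \<open>n\<close>, the
    standard number \<open>n\<close> would belong to the internal set.\<close>
  define m where "m i = (LEAST n. \<iota> n \<in> P i)" for i
  have "\<not> (\<forall>\<^sub>F i in D. m i = n)" for n
  proof
    assume mn: "\<forall>\<^sub>F i in D. m i = n"
    obtain g where "g \<in> G" using G(2) by blast
    from mn PA[OF this] have "\<forall>\<^sub>F i in D. \<iota> n \<in> P i"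
      by eventually_elim (auto simp: m_def intro: LeastI)
    then show False using PB by blast
  qed
  moreover have "\<forall>\<^sub>F i in D. m i \<le> g i" if "g \<in> G" for g
    using PA[OF that] by eventually_elim (auto simp: m_def intro: Least_le)
  ultimately show ?thesis by (auto simp: is_nonstandard_def)
qed

text \<open>For a single \<open>j\<close> the first failure of \<open>\<Phi> j i\<close> is a
  nonstandard number; a nonstandard \<open>m\<close> below all these numbers works for every
  \<open>j\<close> at once.\<close>

lemma uniform_overspill:
  fixes D :: "'i filter" and J :: "'j set"
  assumes D: "is_ultrafilter D" and inf: "infinite (UNIV :: 'i set)" "infinite (UNIV :: 'u set)"
    and "is_regular D" and good: "good_for_random_graph TYPE('u) D" and J: "|J| \<le>o |UNIV :: 'i set|"
    and \<Phi>: "\<And>j n. j \<in> J \<Longrightarrow> \<forall>\<^sub>F i in D. \<Phi> j i n"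
  shows "\<exists>m. is_nonstandard D m \<and> (\<forall>j\<in>J. \<forall>\<^sub>F i in D. \<forall>n<m i. \<Phi> j i n)"
proof -
  obtain N where N: "is_nonstandard D N" using regular_nonstandard[OF D assms(4) inf(1)] by blast
  \<comment> \<open>Where nothing fails below \<open>N i\<close>, the nonstandard \<open>N i\<close>
    serves as the bound. Later \<open>N\<close> itself joins the family of bounds, which keeps it
    nonempty even for empty \<open>J\<close>.\<close>
  define g where "g j i = (if \<forall>n<N i. \<Phi> j i n then N i else LEAST n. \<not> \<Phi> j i n)" for j i
  have g: "\<Phi> j i n" if "n < g j i" for j i n
    using that not_less_Least[of n "\<lambda>n. \<not> \<Phi> j i n"] by (auto simp: g_def split: if_splits)
  have "is_nonstandard D (g j)" if "j \<in> J" for j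
    unfolding nonstandard_gt[OF D]
  proof
    fix c
    have "\<forall>\<^sub>F i in D. \<forall>n\<in>{..c}. \<Phi> j i n" using \<Phi>[OF that] by (intro eventually_ball_finite) auto
    moreover have "\<forall>\<^sub>F i in D. c < N i" using N nonstandard_gt[OF D] by blast
    ultimately show "\<forall>\<^sub>F i in D. c < g j i"
    proof eventually_elim
      case (elim i)
      have "c < (LEAST n. \<not> \<Phi> j i n)" if "\<exists>n. \<not> \<Phi> j i n"
        using LeastI_ex[OF that] elim(1) by (meson atMost_iff not_less)
      then show ?case using elim(2) unfolding g_def by (auto split: if_split)
    qed
  qed
  moreover have "|insert N (g ` J)| \<le>o |UNIV :: 'i set|"
  proof -
    have "|g ` J| \<le>o |UNIV :: 'i set|" by (rule ordLeq_transitive[OF card_of_image J])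
    moreover have "|{N}| \<le>o |UNIV :: 'i set|" by (rule card_of_ordLeqI[of "\<lambda>_. undefined"]) auto
    ultimately have "|{N} \<union> g ` J| \<le>o |UNIV :: 'i set|" by (intro card_of_Un_ordLeq_infinite_Field) (auto simp: inf(1) Field_card_of card_of_card_order_on)
    then show ?thesis by simp
  qed
  ultimately obtain m where m: "is_nonstandard D m" "\<And>j. j \<in> J \<Longrightarrow> \<forall>\<^sub>F i in D. m i \<le> g j i"
    using good_lower_bound[OF D inf good, of "insert N (g ` J)"] N by auto
  have "\<forall>\<^sub>F i in D. \<forall>n<m i. \<Phi> j i n" if "j \<in> J" for j
    using m(2)[OF that] by (rule eventually_mono) (use g in force)
  then show ?thesis using m(1) by blast
qed

section \<open>Internal separation of families of finite sets\<close>

lemma rep_inj_on: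
  assumes D: "is_ultrafilter D" and S: "finite S" "S \<subseteq> upower_set D C"
  shows "\<forall>\<^sub>F i in D. inj_on (\<lambda>c. rep c i) S"
proof -
  have "\<forall>\<^sub>F i in D. rep x i = rep y i \<longrightarrow> x = y" if "x \<in> S" "y \<in> S" for x y
  proof (cases "x = y")
    case False
    then have "\<not> (\<forall>\<^sub>F i in D. rep x i = rep y i)" using rep_eq_iff[of x D C y] that S(2) by blast
    then show ?thesis unfolding ultrafilter_not[OF D] by (rule eventually_mono) simp
  qed simp
  then have "\<forall>\<^sub>F i in D. \<forall>x\<in>S. \<forall>y\<in>S. rep x i = rep y i \<longrightarrow> x = y"
    using S(1) by (intro eventually_ball_finite ballI) auto
  then show ?thesis by (rule eventually_mono) (simp add: inj_on_def)
qed

text \<open>Composing an injection of \<open>A\<close> with a coding of finite sets of indices lets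
  requirements given by finite subsets of \<open>A\<close> be numbered by the index set, as
  flexibility and regularity expect.\<close>

lemma Fpow_small:
  fixes A :: "'a set"
  assumes "infinite (UNIV :: 'i set)" "|A| \<le>o |UNIV :: 'i set|"
  shows "\<exists>e :: 'a set \<Rightarrow> 'i. inj_on e (Fpow A)"
proof -
  obtain j :: "'a \<Rightarrow> 'i" where "inj_on j A" using assms(2) by (metis card_of_ordLeq)
  then have "inj_on ((`) j) (Fpow A)" by (rule inj_on_image_Fpow)
  moreover obtain c :: "'i set \<Rightarrow> 'i" where c: "inj_on c (Fpow UNIV)" using Fpow_inj[OF assms(1)] by blast
  moreover have "(`) j ` Fpow A \<subseteq> Fpow UNIV" by (auto simp: Fpow_def)
  ultimately have "inj_on (c \<circ> (`) j) (Fpow A)" by (meson comp_inj_on inj_on_subset)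
  then show ?thesis by blast
qed

text \<open>Goodness separates sets of elements, so a finite set \<open>S\<close> is replaced by the
  element whose value at \<open>i\<close> codes the image of \<open>S\<close> at \<open>i\<close>.
  Distinct sets get distinct codes, because representatives are almost everywhere injective on their
  union.\<close>

lemma good_separation:
  fixes D :: "'i filter" and C :: "'u set"
  assumes D: "is_ultrafilter D" and inf: "infinite (UNIV :: 'i set)" "infinite C"
    and good: "good_for_random_graph TYPE('u) D"
    and A: "A \<subseteq> upower_set D C" "|A| \<le>o |UNIV :: 'i set|"
    and X: "X \<subseteq> Fpow A" and Y: "Y \<subseteq> Fpow A" and XY: "X \<inter> Y = {}"
  shows "\<exists>P. (\<forall>S\<in>X. \<forall>\<^sub>F i in D. (\<lambda>c. rep c i) ` S \<in> P i) \<and> (\<forall>S\<in>Y. \<forall>\<^sub>F i in D. (\<lambda>c. rep c i) ` S \<notin> P i)"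
proof -
  obtain c where c: "inj_on c (Fpow C)" "c ` Fpow C \<subseteq> C" using Fpow_inj[OF inf(2)] by blast
  define g where "g S = (\<lambda>i. c ((\<lambda>x. rep x i) ` S))" for S :: "('i \<Rightarrow> 'u) set set"
  have img: "(\<lambda>x. rep x i) ` S \<in> Fpow C" if "S \<in> Fpow A" for S i
  proof -
    have "rep x i \<in> C" if "x \<in> S" for x
      using rep(1)[of x D C] that \<open>S \<in> Fpow A\<close> A(1) by (auto simp: Fpow_def)
    then show ?thesis using that by (auto simp: Fpow_def)
  qed
  have g: "g S \<in> UNIV \<rightarrow> C" if "S \<in> Fpow A" for S using img[OF that] c(2) by (auto simp: g_def)
  have neq: "cls D C (g S) \<noteq> cls D C (g S')" if S: "S \<in> Fpow A" "S' \<in> Fpow A" "S \<noteq> S'" for S S'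
  proof
    assume "cls D C (g S) = cls D C (g S')"
    then have "\<forall>\<^sub>F i in D. g S i = g S' i" using cls_eq_iff[OF g[OF S(1)] g[OF S(2)]] by blast
    moreover have "\<forall>\<^sub>F i in D. inj_on (\<lambda>x. rep x i) (S \<union> S')"
      by (rule rep_inj_on[OF D]) (use S A(1) in \<open>auto simp: Fpow_def\<close>)
    ultimately have "\<forall>\<^sub>F i in D. False"
    proof eventually_elim
      case (elim i)
      then have "(\<lambda>x. rep x i) ` S = (\<lambda>x. rep x i) ` S'"
        using inj_onD[OF c(1)] img S by (simp add: g_def)
      then show ?case using elim(2) S(3) by (simp add: inj_on_image_eq_iff)
    qed
    then show False using ultrafilter_nontrivial[OF D] by simp
  qed
  define A' where "A' = (\<lambda>S. cls D C (g S)) ` X"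
  define B' where "B' = (\<lambda>S. cls D C (g S)) ` Y"
  obtain e :: "('i \<Rightarrow> 'u) set set \<Rightarrow> 'i" where e: "inj_on e (Fpow A)" using Fpow_small[OF inf(1) A(2)] by blast
  have small: "|W| \<le>o |UNIV :: 'i set|" if "W \<subseteq> Fpow A" for W
    using inj_on_subset[OF e that] by (intro card_of_ordLeqI[of e]) auto
  have "A' \<subseteq> upower_set D C" "B' \<subseteq> upower_set D C"
    using g X Y by (auto simp: A'_def B'_def intro!: cls_in)
  moreover have "|A'| +c |B'| \<le>o |UNIV :: 'i set|"
    unfolding A'_def B'_def
    by (intro csum_card_of_ordLeq inf ordLeq_transitive[OF card_of_image] small X Y)
  moreover have "A' \<inter> B' = {}"
  proof (rule ccontr)
    assume "A' \<inter> B' \<noteq> {}"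
    then obtain S S' where "S \<in> X" "S' \<in> Y" "cls D C (g S) = cls D C (g S')" by (auto simp: A'_def B'_def)
    then show False using neq[of S S'] X Y XY by blast
  qed
  ultimately obtain P where P: "A' \<subseteq> internal_set D C P" "B' \<inter> internal_set D C P = {}"
    using good inf(2) unfolding good_for_random_graph_def by meson
  have "\<forall>\<^sub>F i in D. (\<lambda>x. rep x i) ` S \<in> {T. c T \<in> P i}" if "S \<in> X" for S
  proof -
    have "cls D C (g S) \<in> internal_set D C P" using P(1) that by (auto simp: A'_def)
    then show ?thesis using internal_set_cls[OF g] that X by (simp add: g_def subset_iff)
  qed
  moreover have "\<forall>\<^sub>F i in D. (\<lambda>x. rep x i) ` S \<notin> {T. c T \<in> P i}" if "S \<in> Y" for S
  proof -
    have "cls D C (g S) \<notin> internal_set D C P" using P(2) that by (auto simp: B'_def)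
    then have "\<not> (\<forall>\<^sub>F i in D. g S i \<in> P i)" using internal_set_cls[OF g] that Y by (simp add: subset_iff)
    then show ?thesis unfolding ultrafilter_not[OF D] by (simp add: g_def)
  qed
  ultimately show ?thesis by (intro exI[of _ "\<lambda>i. {T. c T \<in> P i}"]) blast
qed

text \<open>The element is built index by index. Only the finitely many requirements active at an
  index are imposed there, while each single requirement is active almost everywhere.\<close>

lemma realize_one_point_extension:
  fixes D :: "'i filter" and C :: "'u set"
  assumes D: "is_ultrafilter D" "is_regular D" "is_flexible D" "good_for_random_graph TYPE('u) D"
    and inf: "infinite (UNIV :: 'i set)" "infinite C"
    and tg: "tree_graph k H E C br r" and ope: "one_point_extensions k H E f C br r"
    and f: "filterlim f at_top sequentially"
    and A: "A \<subseteq> upower_set D C" "|A| \<le>o |UNIV :: 'i set|"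
    and \<beta>: "\<And>n. \<beta> n < H n" and X: "X \<subseteq> ksets (k - 1) A" and Y: "Y \<subseteq> ksets (k - 1) A" and XY: "X \<inter> Y = {}"
    and edge: "\<And>S n. S \<in> X \<Longrightarrow>
      \<forall>\<^sub>F i in D. insert (\<beta> n) ((\<lambda>x. br x n) ` (\<lambda>c. rep c i) ` S) \<in> set ` E n"
  shows "\<exists>b. (\<forall>i. b i \<in> C) \<and> (\<forall>n. \<forall>\<^sub>F i in D. br (b i) n = \<beta> n) \<and>
    (\<forall>S\<in>X. \<forall>\<^sub>F i in D. insert (b i) ((\<lambda>c. rep c i) ` S) \<in> r) \<and>
    (\<forall>S\<in>Y. \<forall>\<^sub>F i in D. insert (b i) ((\<lambda>c. rep c i) ` S) \<notin> r) \<and>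
    (\<forall>a\<in>A. \<forall>\<^sub>F i in D. b i \<noteq> rep a i)"
proof -
  define img where "img i S = (\<lambda>c. rep c i) ` S" for i and S :: "('i \<Rightarrow> 'u) set set"
  have Fpow: "X \<subseteq> Fpow A" "Y \<subseteq> Fpow A" using X Y by (auto simp: ksets_def Fpow_def)
  obtain P where P: "\<And>S. S \<in> X \<Longrightarrow> \<forall>\<^sub>F i in D. img i S \<in> P i" "\<And>S. S \<in> Y \<Longrightarrow> \<forall>\<^sub>F i in D. img i S \<notin> P i"
    using good_separation[OF D(1) inf D(4) A Fpow XY] unfolding img_def by blast
  obtain e :: "('i \<Rightarrow> 'u) set set \<Rightarrow> 'i" where e: "inj_on e (Fpow A)" using Fpow_small[OF inf(1) A(2)] by blast
  have "|X| \<le>o |UNIV :: 'i set|" using inj_on_subset[OF e Fpow(1)] by (intro card_of_ordLeqI[of e]) auto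
  moreover have infU: "infinite (UNIV :: 'u set)" using inf(2) by (meson finite_subset subset_UNIV)
  ultimately obtain m where m: "is_nonstandard D m"
    "\<And>S. S \<in> X \<Longrightarrow> \<forall>\<^sub>F i in D. \<forall>n<m i. insert (\<beta> n) ((\<lambda>x. br x n) ` img i S) \<in> set ` E n"
    using uniform_overspill[OF D(1) inf(1) infU D(2,4), of X
      "\<lambda>S i n. insert (\<beta> n) ((\<lambda>x. br x n) ` img i S) \<in> set ` E n"] edge unfolding img_def by blast
  \<comment> \<open>The least value of \<open>f\<close> from level \<open>m i\<close> on bounds the
    number of positive requirements that can be met at \<open>i\<close>. It is nonstandard, as
    \<open>m\<close> is nonstandard and \<open>f\<close> tends to infinity.\<close>
  define t where "t i = (LEAST c. \<exists>n\<ge>m i. f n = c)" for i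
  have t: "t i \<le> f n" if "n \<ge> m i" for i n unfolding t_def by (rule Least_le) (use that in blast)
  have "is_nonstandard D t"
    unfolding nonstandard_gt[OF D(1)]
  proof
    fix c
    have "\<forall>\<^sub>F n in sequentially. f n \<ge> Suc c" using f by (simp add: filterlim_at_top)
    then obtain n0 where n0: "\<And>n. n \<ge> n0 \<Longrightarrow> f n \<ge> Suc c" by (auto simp: eventually_sequentially)
    have "\<forall>\<^sub>F i in D. n0 < m i" using m(1) nonstandard_gt[OF D(1)] by blast
    then show "\<forall>\<^sub>F i in D. c < t i"
    proof (rule eventually_mono)
      fix i assume "n0 < m i"
      have "\<exists>n\<ge>m i. f n = t i" unfolding t_def by (rule LeastI_ex) blast
      then show "c < t i" using n0 \<open>n0 < m i\<close> by (metis Suc_le_eq less_imp_le order_trans)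
    qed
  qed
  then obtain W :: "'i \<Rightarrow> 'i set" where W: "\<And>\<alpha>. \<forall>\<^sub>F i in D. i \<in> W \<alpha>"
    "\<And>i. finite {\<alpha>. i \<in> W \<alpha>}" "\<And>i. card {\<alpha>. i \<in> W \<alpha>} \<le> t i"
    using D(3) unfolding is_flexible_def by meson
  \<comment> \<open>All finite subsets of \<open>A\<close> are numbered by one family: those in
    \<open>X\<close> and \<open>Y\<close> stand for conditions on hyperedges, singletons for
    elements to be avoided.\<close>
  define active where "active i = {S \<in> Fpow A. i \<in> W (e S)}" for i
  have act: "finite (active i)" "card (active i) \<le> t i" for i
  proof -
    have "e ` active i \<subseteq> {\<alpha>. i \<in> W \<alpha>}" "inj_on e (active i)"
      using e by (auto simp: active_def intro: inj_on_subset)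
    then show "finite (active i)" "card (active i) \<le> t i"
      using W(2,3)[of i] by (meson inj_on_finite, meson card_inj_on_le order_trans)
  qed
  have act_ev: "\<forall>\<^sub>F i in D. S \<in> active i" if "S \<in> Fpow A" for S
    using W(1)[of "e S"] that by (simp add: active_def)
  \<comment> \<open>Injectivity keeps the image of a \<open>(k - 1)\<close>-set at size
    \<open>k - 1\<close>.\<close>
  define good where "good i S \<longleftrightarrow> S \<in> active i \<and> inj_on (\<lambda>c. rep c i) S" for i S
  have good_ev: "\<forall>\<^sub>F i in D. good i S" if S: "S \<in> Fpow A" for S
  proof -
    have "\<forall>\<^sub>F i in D. inj_on (\<lambda>c. rep c i) S"
      by (rule rep_inj_on[OF D(1)]) (use S A(1) in \<open>auto simp: Fpow_def\<close>)
    then show ?thesis using act_ev[OF S] unfolding good_def by eventually_elim simp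
  qed
  \<comment> \<open>Sets from \<open>X\<close> and \<open>Y\<close> may have the same image at an
    index; testing the image against \<open>P i\<close> keeps the two families of images disjoint.
    For each fixed set the extra conditions hold almost everywhere.\<close>
  define Xi where "Xi i = {S \<in> X. good i S \<and> img i S \<in> P i \<and>
    (\<forall>n<m i. insert (\<beta> n) ((\<lambda>x. br x n) ` img i S) \<in> set ` E n)}" for i
  define Yi where "Yi i = {S \<in> Y. good i S \<and> img i S \<notin> P i}" for i
  define Zi where "Zi i = (\<lambda>a. rep a i) ` {a \<in> A. {a} \<in> active i}" for i
  have repC: "rep a i \<in> C" if "a \<in> A" for a i using rep(1)[of a D C] that A(1) by auto
  have ks: "img i S \<in> ksets (k - 1) C" if "S \<in> X \<union> Y" "good i S" for i S
  proof -
    have S: "S \<subseteq> A" "finite S" "card S = k - 1" using that(1) X Y by (auto simp: ksets_def)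
    moreover have "img i S \<subseteq> C" using S(1) repC by (auto simp: img_def)
    ultimately show ?thesis using that(2) by (simp add: good_def img_def ksets_def card_image)
  qed
  have "\<exists>b\<in>C - Zi i. (\<forall>n<m i. br b n = \<beta> n) \<and> (\<forall>T\<in>img i ` Xi i. insert b T \<in> r) \<and>
    (\<forall>T\<in>img i ` Yi i. insert b T \<notin> r)" for i
  proof (rule ope[unfolded one_point_extensions_def, rule_format], intro conjI)
    have XYi: "Xi i \<subseteq> active i" "Yi i \<subseteq> active i" by (auto simp: Xi_def Yi_def good_def)
    then show "finite (img i ` Xi i)" "finite (img i ` Yi i)" 
      using act(1) by (meson finite_imageI finite_subset)+
    have "finite {a \<in> A. {a} \<in> active i}"
      by (rule inj_on_finite[of "\<lambda>a. {a}" _ "active i"]) (use act(1) in auto)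
    then show "finite (Zi i)" by (simp add: Zi_def)
    show "img i ` Xi i \<subseteq> ksets (k - 1) C" "img i ` Yi i \<subseteq> ksets (k - 1) C"
      using ks by (auto simp: Xi_def Yi_def)
    show "img i ` Xi i \<inter> img i ` Yi i = {}" by (auto simp: Xi_def Yi_def)
    show "Zi i \<subseteq> C" using repC by (auto simp: Zi_def)
    show "\<forall>n<m i. \<beta> n < H n" using \<beta> by blast
    show "\<forall>T\<in>img i ` Xi i. \<forall>n<m i. insert (\<beta> n) ((\<lambda>x. br x n) ` T) \<in> set ` E n" by (auto simp: Xi_def)
    show "\<forall>n\<ge>m i. card (img i ` Xi i) \<le> f n"
    proof (intro allI impI)
      fix n assume n: "m i \<le> n"
      have "card (img i ` Xi i) \<le> card (Xi i)"
        using XYi(1) act(1) by (intro card_image_le) (auto intro: finite_subset)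
      also have "\<dots> \<le> card (active i)" using XYi(1) act(1) by (intro card_mono)
      also have "\<dots> \<le> t i" by (rule act(2))
      also have "\<dots> \<le> f n" by (rule t[OF n])
      finally show "card (img i ` Xi i) \<le> f n" .
    qed
  qed
  then obtain b where b: "\<And>i. b i \<in> C" "\<And>i. b i \<notin> Zi i" "\<And>i n. n < m i \<Longrightarrow> br (b i) n = \<beta> n"
    "\<And>i S. S \<in> Xi i \<Longrightarrow> insert (b i) (img i S) \<in> r" "\<And>i S. S \<in> Yi i \<Longrightarrow> insert (b i) (img i S) \<notin> r"
    by (metis DiffD1 DiffD2 imageI)
  have "\<forall>\<^sub>F i in D. br (b i) n = \<beta> n" for n
  proof -
    have "\<forall>\<^sub>F i in D. n < m i" using m(1) nonstandard_gt[OF D(1)] by blast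
    then show ?thesis by (rule eventually_mono) (rule b(3))
  qed
  moreover have "\<forall>\<^sub>F i in D. insert (b i) (img i S) \<in> r" if S: "S \<in> X" for S
  proof -
    have "\<forall>\<^sub>F i in D. good i S" using S Fpow by (intro good_ev) blast
    then show ?thesis using P(1)[OF S] m(2)[OF S]
      by eventually_elim (use S in \<open>auto simp: Xi_def intro: b(4)\<close>)
  qed
  moreover have "\<forall>\<^sub>F i in D. insert (b i) (img i S) \<notin> r" if S: "S \<in> Y" for S
  proof -
    have "\<forall>\<^sub>F i in D. good i S" using S Fpow by (intro good_ev) blast
    then show ?thesis using P(2)[OF S]
    proof eventually_elim
      case (elim i)
      then show ?case using S by (intro b(5)) (simp add: Yi_def)
    qed
  qed
  moreover have "\<forall>\<^sub>F i in D. b i \<noteq> rep a i" if a: "a \<in> A" for a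
  proof -
    have "\<forall>\<^sub>F i in D. {a} \<in> active i" by (rule act_ev) (use a in \<open>simp add: Fpow_def\<close>)
    then show ?thesis
    proof (rule eventually_mono)
      fix i assume "{a} \<in> active i"
      then have "rep a i \<in> Zi i" using a by (simp add: Zi_def)
      then show "b i \<noteq> rep a i" using b(2)[of i] by metis
    qed
  qed
  ultimately show ?thesis using b(1) unfolding img_def by (intro exI[of _ b]) blast
qed

text \<open>Hyperedges have exactly \<open>k\<close> elements, while this set has
  \<open>card T + 1\<close> elements almost everywhere. It settles the parameter sets of the wrong
  size, which lie in neither the positive nor the negative family.\<close>

lemma rep_image_not_related:
  assumes D: "is_ultrafilter D" and tg: "tree_graph k H E C br r" and k: "k \<ge> 1"
    and T: "finite T" "T \<subseteq> upower_set D C" "card T \<noteq> k - 1"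
    and z: "\<And>c. c \<in> T \<Longrightarrow> \<forall>\<^sub>F i in D. z i \<noteq> rep c i"
  shows "\<forall>\<^sub>F i in D. insert (z i) ((\<lambda>c. rep c i) ` T) \<notin> r"
proof -
  have "\<forall>\<^sub>F i in D. \<forall>c\<in>T. z i \<noteq> rep c i" using T(1) z by (intro eventually_ball_finite) auto
  then show ?thesis using rep_inj_on[OF D T(1,2)]
  proof eventually_elim
    case (elim i)
    have "card (insert (z i) ((\<lambda>c. rep c i) ` T)) = Suc (card ((\<lambda>c. rep c i) ` T))"
      using elim(1) T(1) by (intro card_insert_disjoint) auto
    also have "\<dots> = Suc (card T)" using elim(2) by (simp add: card_image)
    finally show ?case using T(3) k tg by (auto simp: tree_graph_def)
  qed
qed

section \<open>Saturation of the ultrapower\<close>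

theorem corollary4p4:
  fixes k :: nat and H :: "nat \<Rightarrow> nat" and E :: "nat \<Rightarrow> nat list set"
    and T :: "sym fm set" and M :: "(sym, 'u) struct" and D :: "'i filter"
  assumes "is_template k H E"
    and "is_model_completion TYPE('u) (T0_lang k H) (T0 k H E) T"
    and "models (T0_lang k H) M T"
    and "infinite (UNIV :: 'i set)"
    and "is_ultrafilter D"
    and "is_regular D"
    and "is_flexible D"
    and "good_for_random_graph TYPE('u) D"
  shows "saturated (cardSuc |UNIV :: 'i set| ) (T0_lang k H) (ultrapower D M)"
  unfolding saturated_def
proof (intro allI impI; elim conjE)
  fix A \<Sigma>
  let ?L = "T0_lang k H" and ?N = "ultrapower D M"
  define C where "C = carrier M"
  define N where "N = upower_set D C"
  have carrier_N: "carrier ?N = N" by (simp add: ultrapower_def N_def C_def)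
  note D = assms(5)
  assume "A \<subseteq> carrier ?N" and small: "|A| <o cardSuc |UNIV :: 'i set|"
    and par: "\<forall>(p, v)\<in>\<Sigma>. is_fm ?L p \<and> (\<forall>x\<in>free_vars p - {0}. v x \<in> A)"
    and fsat: "\<forall>\<Delta>\<subseteq>\<Sigma>. finite \<Delta> \<longrightarrow> (\<exists>b\<in>carrier ?N. \<forall>(p, v)\<in>\<Delta>. sat ?N (v(0 := b)) p)"
  then have A: "A \<subseteq> N" by (simp add: carrier_N)
  have A_small: "|A| \<le>o |UNIV :: 'i set|"
    using cardSuc_ordLeq_ordLess[OF card_of_Card_order card_of_Card_order] small by blast
  have k: "k \<ge> 1" using assms(1) by (simp add: is_template_def)
  have MT0: "models ?L M (T0 k H E)"
    using assms(2,3) unfolding is_model_completion_def by metis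
  obtain br r where tg: "tree_graph k H E C br r" and pres: "presents k H M br r"
    using T0_decode[OF assms(1) MT0] unfolding C_def by blast
  obtain f where f: "filterlim f at_top sequentially"
    and ext: "\<And>n \<L>. finite \<L> \<Longrightarrow> \<L> \<subseteq> tuples (k - 1) {..<H n} \<Longrightarrow> card \<L> \<le> f n \<Longrightarrow>
      \<exists>s<H n. \<forall>xs\<in>\<L>. s # xs \<in> E n"
    by (rule template_extension[OF assms(1)]) blast
  have brH: "br x n < H n" if "x \<in> C" for x n using tg that by (simp add: tree_graph_def)
  have repC: "rep b i \<in> C" if "b \<in> N" for b i using rep(1)[of b D C] that by (auto simp: N_def)
  define sol where "sol q = {b \<in> N. sat ?N ((snd q)(0 := b)) (fst q)}" for q
  \<comment> \<open>Finite satisfiability gives the solution sets the finite intersection property,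
    so an ultrafilter \<open>U\<close> containing them completes the type. Including
    \<open>N\<close> makes \<open>U\<close> live on the ultrapower.\<close>
  have "\<exists>U. is_ultrafilter U \<and> (\<forall>S\<in>insert N (sol ` \<Sigma>). \<forall>\<^sub>F b in U. b \<in> S)"
  proof (rule ultrafilter_extension)
    fix \<F> assume \<F>: "finite \<F>" "\<F> \<subseteq> insert N (sol ` \<Sigma>)"
    then have "finite (\<F> - {N})" "\<F> - {N} \<subseteq> sol ` \<Sigma>" by auto
    then obtain \<Delta> where \<Delta>: "\<Delta> \<subseteq> \<Sigma>" "finite \<Delta>" "\<F> - {N} = sol ` \<Delta>"
      by (meson finite_subset_image)
    then obtain b where b: "b \<in> N" "\<forall>(p, v)\<in>\<Delta>. sat ?N (v(0 := b)) p"
      using fsat by (metis carrier_N)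
    have "b \<in> S" if "S \<in> \<F>" for S
    proof (cases "S = N")
      case False
      then have "S \<in> sol ` \<Delta>" using that \<Delta>(3) by blast
      then show ?thesis using b by (auto simp: sol_def)
    qed (use b in simp)
    then show "\<Inter>\<F> \<noteq> {}" by blast
  qed
  then obtain U where U: "is_ultrafilter U" and U_N: "\<forall>\<^sub>F b in U. b \<in> N"
    and U_sol: "\<And>q. q \<in> \<Sigma> \<Longrightarrow> \<forall>\<^sub>F b in U. b \<in> sol q" by auto
  \<comment> \<open>If \<open>U\<close> is principal at some \<open>a\<close>, then \<open>a\<close>
    lies in every solution set. Otherwise \<open>U\<close> excludes each single element, and a new
    one has to be constructed.\<close>
  show "\<exists>b\<in>carrier ?N. \<forall>(p, v)\<in>\<Sigma>. sat ?N (v(0 := b)) p"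
  proof (cases "\<exists>a\<in>N. \<forall>\<^sub>F b in U. b = a")
    case True
    then obtain a where a: "a \<in> N" "\<forall>\<^sub>F b in U. b = a" by blast
    have "a \<in> sol q" if "q \<in> \<Sigma>" for q
    proof -
      have "\<forall>\<^sub>F b in U. a \<in> sol q" using U_sol[OF that] a(2) by eventually_elim simp
      then show ?thesis using ultrafilter_nontrivial[OF U] by simp
    qed
    then show ?thesis using a(1) unfolding carrier_N by (intro bexI[of _ a]) (auto simp: sol_def)
  next
    case False
    have U_neq: "\<forall>\<^sub>F b in U. b \<noteq> a" if "a \<in> N" for a
      using False that ultrafilter_not[OF U, of "\<lambda>b. b = a"] by simp
    \<comment> \<open>Over a finite carrier every element of the ultrapower is almost everywhere
      constant, so the ultrapower is finite and \<open>U\<close> would concentrate at a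
      point.\<close>
    have inf_C: "infinite C"
    proof
      assume C: "finite C"
      have "N \<subseteq> (\<lambda>c. cls D C (\<lambda>_. c)) ` C"
      proof
        fix b assume b: "b \<in> N"
        obtain c where c: "c \<in> C" "\<forall>\<^sub>F i in D. rep b i = c"
          using ultrafilter_finite_range[OF D C, of "rep b"] repC[OF b] by auto
        then have "cls D C (rep b) = cls D C (\<lambda>_. c)"
          using repC[OF b] by (subst cls_eq_iff) auto
        then show "b \<in> (\<lambda>c. cls D C (\<lambda>_. c)) ` C" using rep(2)[of b D C] b c(1) by (auto simp: N_def)
      qed
      then have "finite N" using C by (meson finite_imageI finite_subset)
      then show False using ultrafilter_finite_range[OF U, of N "\<lambda>b. b"] U_N False by blast
    qed
    have ope: "one_point_extensions k H E f C br r"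
      using model_completion_extensions[OF assms(1-3) _ pres, of f] inf_C tg ext unfolding C_def by blast
    \<comment> \<open>Each level has finitely many vertices, so every element \<open>b\<close> of
      the ultrapower has a standard branch \<open>col b\<close>, and \<open>U\<close> selects one
      branch \<open>\<beta>\<close> as their limit.\<close>
    have "\<exists>c\<in>{..<H n}. \<forall>\<^sub>F i in D. br (rep b i) n = c" if "b \<in> N" for b n
      by (rule ultrafilter_finite_range[OF D]) (use repC[OF that] brH in auto)
    then obtain col where col: "\<And>b n. b \<in> N \<Longrightarrow> col b n < H n"
      "\<And>b n. b \<in> N \<Longrightarrow> \<forall>\<^sub>F i in D. br (rep b i) n = col b n" by (metis lessThan_iff)
    have "\<exists>c\<in>{..<H n}. \<forall>\<^sub>F b in U. col b n = c" for n
      by (rule ultrafilter_finite_range[OF U finite_lessThan])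
        (rule eventually_mono[OF U_N], simp add: col(1))
    then obtain \<beta> where \<beta>: "\<And>n. \<beta> n < H n" "\<And>n. \<forall>\<^sub>F b in U. col b n = \<beta> n" by (metis lessThan_iff)
    have U_\<beta>: "\<forall>\<^sub>F b in U. \<forall>\<^sub>F i in D. br (rep b i) n = \<beta> n" for n
      using U_N \<beta>(2)[of n]
    proof eventually_elim
      case (elim b)
      then show ?case using col(2)[of b n] by simp
    qed
    define img where "img i S = (\<lambda>c. rep c i) ` S" for i and S :: "('i \<Rightarrow> 'u) set set"
    \<comment> \<open>The completed type decides every \<open>(k - 1)\<close>-subset of
      \<open>A\<close>: since \<open>U\<close> and \<open>D\<close> are both ultrafilters, a set
      outside \<open>X\<close> is almost everywhere not joined to \<open>U\<close>-almost every
      \<open>b\<close>.\<close>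
    define X where "X = {S \<in> ksets (k - 1) A. \<forall>\<^sub>F b in U. \<forall>\<^sub>F i in D. insert (rep b i) (img i S) \<in> r}"
    define Y where "Y = ksets (k - 1) A - X"
    have U_X: "\<forall>\<^sub>F b in U. \<forall>\<^sub>F i in D. insert (rep b i) (img i S) \<in> r" if "S \<in> X" for S
      using that by (simp add: X_def)
    have U_Y: "\<forall>\<^sub>F b in U. \<forall>\<^sub>F i in D. insert (rep b i) (img i S) \<notin> r" if "S \<in> Y" for S
    proof -
      have "\<not> (\<forall>\<^sub>F b in U. \<forall>\<^sub>F i in D. insert (rep b i) (img i S) \<in> r)" using that by (simp add: X_def Y_def)
      then show ?thesis by (simp only: ultrafilter_not[OF U] ultrafilter_not[OF D])
    qed
    \<comment> \<open>Some \<open>b\<close> has entry \<open>\<beta> n\<close> and is joined to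
      \<open>S\<close> at almost every index; projecting these hyperedges to level \<open>n\<close>
      gives the edge.\<close>
    have edge: "\<forall>\<^sub>F i in D. insert (\<beta> n) ((\<lambda>x. br x n) ` img i S) \<in> set ` E n" if "S \<in> X" for S n
    proof -
      have "\<forall>\<^sub>F b in U. (\<forall>\<^sub>F i in D. br (rep b i) n = \<beta> n) \<and> (\<forall>\<^sub>F i in D. insert (rep b i) (img i S) \<in> r)"
        using U_\<beta> U_X[OF that] by (intro eventually_conj)
      then obtain b where b: "\<forall>\<^sub>F i in D. br (rep b i) n = \<beta> n" "\<forall>\<^sub>F i in D. insert (rep b i) (img i S) \<in> r"
        using ultrafilter_ex[OF U] by blast
      then show ?thesis
      proof eventually_elim
        case (elim i)
        then have "(\<lambda>x. br x n) ` insert (rep b i) (img i S) \<in> set ` E n"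
          using tg by (simp only: tree_graph_def)
        then show ?case using elim(1) by simp
      qed
    qed
    have XY: "X \<subseteq> ksets (k - 1) A" "Y \<subseteq> ksets (k - 1) A" "X \<inter> Y = {}" by (auto simp: X_def Y_def)
    obtain b where b: "\<And>i. b i \<in> C" "\<And>n. \<forall>\<^sub>F i in D. br (b i) n = \<beta> n"
      "\<And>S. S \<in> X \<Longrightarrow> \<forall>\<^sub>F i in D. insert (b i) (img i S) \<in> r"
      "\<And>S. S \<in> Y \<Longrightarrow> \<forall>\<^sub>F i in D. insert (b i) (img i S) \<notin> r"
      "\<And>a. a \<in> A \<Longrightarrow> \<forall>\<^sub>F i in D. b i \<noteq> rep a i"
      using realize_one_point_extension[OF D assms(6-8,4) inf_C tg ope f A[unfolded N_def] A_small
          \<beta>(1) XY edge[unfolded img_def], folded img_def]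
      by blast
    have bC: "b \<in> UNIV \<rightarrow> C" using b(1) by simp
    define B where "B = cls D C b"
    have BN: "B \<in> N" by (simp add: B_def N_def cls_in[OF bC])
    \<comment> \<open>\<open>B\<close> is compared with a \<open>U\<close>-typical solution
      \<open>b'\<close> of \<open>p\<close>: at almost every index both have the same type, up to a
      finite level, over the parameters of \<open>p\<close>.\<close>
    have "sat ?N (v(0 := B)) p" if "(p, v) \<in> \<Sigma>" for p v
    proof -
      define V where "V = free_vars p"
      have p: "is_fm ?L p" and vA: "\<And>x. x \<in> V \<Longrightarrow> x \<noteq> 0 \<Longrightarrow> v x \<in> A"
        using par that by (auto simp: V_def)
      have fin_V: "finite V" by (simp add: V_def finite_free_vars)
      \<comment> \<open>Values of \<open>v\<close> at \<open>0\<close> or at variables not free in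
        \<open>p\<close> may lie outside the ultrapower; replacing them by \<open>B\<close> makes
        Los's theorem applicable.\<close>
      define v' where "v' x = (if x \<in> V - {0} then v x else B)" for x
      have v'N: "v' x \<in> N" for x using vA A BN by (auto simp: v'_def)
      \<comment> \<open>The functions \<open>z = rep b'\<close> and \<open>z = b\<close> at variable
        \<open>0\<close> will give the two families of assignments in \<open>M\<close> to be
        compared.\<close>
      define F where "F z x = (if x = 0 then z else rep (v' x))" for z and x :: nat
      have F: "F z x \<in> UNIV \<rightarrow> carrier M" if "z \<in> UNIV \<rightarrow> C" for z x
        using that repC[OF v'N] by (auto simp: F_def C_def)
      have sat_F: "sat ?N (v(0 := cls D C z)) p \<longleftrightarrow> (\<forall>\<^sub>F i in D. sat M (\<lambda>x. F z x i) p)" if z: "z \<in> UNIV \<rightarrow> C" for z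
      proof -
        have "sat ?N (v(0 := cls D C z)) p \<longleftrightarrow> sat ?N (\<lambda>x. cls D (carrier M) (F z x)) p"
        proof (rule sat_cong)
          fix x assume x: "x \<in> free_vars p"
          have "cls D C (rep (v' x)) = v' x" using rep(2)[of "v' x" D C] v'N[of x] by (simp add: N_def)
          then show "(v(0 := cls D C z)) x = cls D (carrier M) (F z x)"
            using x by (cases "x = 0") (simp_all add: F_def C_def v'_def V_def)
        qed
        then show ?thesis using Los[OF D F[OF z]] by simp
      qed
      obtain m where m: "\<And>v w. (\<forall>y. v y \<in> C) \<Longrightarrow> (\<forall>y. w y \<in> C) \<Longrightarrow> same_type br r m V v w \<Longrightarrow>
          sat M v p \<longleftrightarrow> sat M w p"
        using quantifier_elimination[OF pres _ k _ f p] tg ope unfolding C_def V_def by blast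
      define W where "W = v ` (V - {0})"
      have W: "finite W" "W \<subseteq> A" using fin_V vA by (auto simp: W_def)
      \<comment> \<open>Only levels below \<open>m\<close> and subsets of the finite set
        \<open>W\<close> are involved, so this is a finite conjunction of \<open>U\<close>-large
        conditions, met by a single \<open>b'\<close>.\<close>
      have "\<forall>\<^sub>F b' in U. b' \<in> N \<and> b' \<in> sol (p, v) \<and> (\<forall>a\<in>W. b' \<noteq> a) \<and>
        (\<forall>n\<in>{..<m}. \<forall>\<^sub>F i in D. br (rep b' i) n = \<beta> n) \<and>
        (\<forall>S\<in>Pow W. S \<in> X \<longrightarrow> (\<forall>\<^sub>F i in D. insert (rep b' i) (img i S) \<in> r)) \<and>
        (\<forall>S\<in>Pow W. S \<in> Y \<longrightarrow> (\<forall>\<^sub>F i in D. insert (rep b' i) (img i S) \<notin> r))"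
      proof (intro eventually_conj U_N U_sol[OF that] eventually_ball_finite ballI U_\<beta>)
        show "\<forall>\<^sub>F b' in U. b' \<noteq> a" if "a \<in> W" for a using U_neq that W(2) A by blast
        show "\<forall>\<^sub>F b' in U. S \<in> X \<longrightarrow> (\<forall>\<^sub>F i in D. insert (rep b' i) (img i S) \<in> r)" for S
          by (cases "S \<in> X") (simp_all add: U_X)
        show "\<forall>\<^sub>F b' in U. S \<in> Y \<longrightarrow> (\<forall>\<^sub>F i in D. insert (rep b' i) (img i S) \<notin> r)" for S
          by (cases "S \<in> Y") (simp_all add: U_Y)
      qed (use W in auto)
      then obtain b' where b': "b' \<in> N" "b' \<in> sol (p, v)" "\<And>a. a \<in> W \<Longrightarrow> b' \<noteq> a"
        "\<And>n. n < m \<Longrightarrow> \<forall>\<^sub>F i in D. br (rep b' i) n = \<beta> n"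
        "\<And>S. S \<subseteq> W \<Longrightarrow> S \<in> X \<Longrightarrow> \<forall>\<^sub>F i in D. insert (rep b' i) (img i S) \<in> r"
        "\<And>S. S \<subseteq> W \<Longrightarrow> S \<in> Y \<Longrightarrow> \<forall>\<^sub>F i in D. insert (rep b' i) (img i S) \<notin> r"
        using ultrafilter_ex[OF U] by (auto dest!: ultrafilter_ex[OF U])
      have b'C: "rep b' \<in> UNIV \<rightarrow> C" "cls D C (rep b') = b'" using rep[of b' D C] b'(1) by (simp_all add: N_def)
      have b'_neq: "\<forall>\<^sub>F i in D. rep b' i \<noteq> rep a i" if "a \<in> W" for a
      proof -
        have "a \<in> N" "b' \<noteq> a" using that W(2) A b'(3) by auto
        then have "\<not> (\<forall>\<^sub>F i in D. rep b' i = rep a i)"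
          using rep_eq_iff[of b' D C a] b'(1) by (simp add: N_def)
        then show ?thesis by (simp only: ultrafilter_not[OF D])
      qed
      have v'_W: "v' x \<in> W" "v' x = v x" if "x \<in> V" "x \<noteq> 0" for x using that by (auto simp: v'_def W_def)

      \<comment> \<open>Equalities between the new element and a parameter of \<open>p\<close> fail
        almost everywhere, for \<open>b'\<close> as well as for \<open>b\<close>.\<close>
      have eq_ev: "\<forall>\<^sub>F i in D. F (rep b') x i = F (rep b') y i \<longleftrightarrow> F b x i = F b y i"
        if "x \<in> V" "y \<in> V" for x y
      proof -
        have neq: "\<forall>\<^sub>F i in D. rep b' i \<noteq> rep (v' x) i \<and> b i \<noteq> rep (v' x) i" if "x \<in> V" "x \<noteq> 0" for x
          using b'_neq b(5) v'_W(1)[OF that] W(2) by (intro eventually_conj) auto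
        consider "x = 0 \<longleftrightarrow> y = 0" | "x = 0" "y \<noteq> 0" | "x \<noteq> 0" "y = 0" by blast
        then show ?thesis
        proof cases
          case 1
          then show ?thesis by (auto simp: F_def)
        next
          case 2
          then show ?thesis using neq[of y] that by (auto simp: F_def elim: eventually_mono)
        next
          case 3
          then show ?thesis using neq[of x] that by (auto simp: F_def elim!: eventually_mono)
        qed
      qed
      have br_ev: "\<forall>\<^sub>F i in D. br (F (rep b') x i) n = br (F b x i) n" if "n < m" for x n
      proof (cases "x = 0")
        case True
        from b'(4)[OF that] b(2)[of n] show ?thesis by eventually_elim (simp add: F_def True)
      qed (simp add: F_def)
      have r_ev: "\<forall>\<^sub>F i in D. (\<lambda>x. F (rep b') x i) ` S \<in> r \<longleftrightarrow> (\<lambda>x. F b x i) ` S \<in> r" if S: "S \<subseteq> V" for S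
      proof (cases "0 \<in> S")
        case False
        then have "(\<lambda>x. F (rep b') x i) ` S = (\<lambda>x. F b x i) ` S" for i
          by (intro image_cong) (auto simp: F_def)
        then show ?thesis by simp
      next
        case True
        \<comment> \<open>A set of variables containing \<open>0\<close> is sent to the new element
          joined to the image of \<open>T\<close>. Membership of \<open>T\<close> in
          \<open>X\<close> or \<open>Y\<close>, or else its size, then gives the same answer for
          \<open>b'\<close> and \<open>b\<close>.\<close>
        define T where "T = v ` (S - {0})"
        have T: "T \<subseteq> W" "finite T" using S fin_V by (auto simp: T_def W_def intro: finite_subset)
        have F_img: "(\<lambda>x. F z x i) ` S = insert (z i) (img i T)" for z i
        proof -
          have "(\<lambda>x. F z x i) ` S = (\<lambda>x. F z x i) ` insert 0 (S - {0})" using True by (simp add: insert_absorb)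
          also have "\<dots> = insert (z i) ((\<lambda>x. F z x i) ` (S - {0}))"
            by (simp only: image_insert) (simp only: F_def if_True simp_thms)
          also have "(\<lambda>x. F z x i) ` (S - {0}) = (\<lambda>x. rep (v x) i) ` (S - {0})"
            using S v'_W(2) by (intro image_cong) (auto simp: F_def)
          also have "\<dots> = img i T" by (simp add: img_def T_def image_image)
          finally show ?thesis .
        qed
        consider "T \<in> X" | "T \<in> Y" | "card T \<noteq> k - 1" using T W(2) by (auto simp: X_def Y_def ksets_def)
        then show ?thesis unfolding F_img
        proof cases
          case 1
          from b'(5)[OF T(1) 1] b(3)[OF 1]
          show "\<forall>\<^sub>F i in D. insert (rep b' i) (img i T) \<in> r \<longleftrightarrow> insert (b i) (img i T) \<in> r"
            by eventually_elim simp
        next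
          case 2
          from b'(6)[OF T(1) 2] b(4)[OF 2]
          show "\<forall>\<^sub>F i in D. insert (rep b' i) (img i T) \<in> r \<longleftrightarrow> insert (b i) (img i T) \<in> r"
            by eventually_elim simp
        next
          case 3
          have TN: "T \<subseteq> upower_set D C" using T W(2) A by (auto simp: N_def)
          have "\<forall>\<^sub>F i in D. insert (rep b' i) (img i T) \<notin> r" "\<forall>\<^sub>F i in D. insert (b i) (img i T) \<notin> r"
            unfolding img_def
            by (rule rep_image_not_related[OF D tg k T(2) TN 3]; use T W(2) b'_neq b(5) in blast)+
          then show "\<forall>\<^sub>F i in D. insert (rep b' i) (img i T) \<in> r \<longleftrightarrow> insert (b i) (img i T) \<in> r"
            by eventually_elim simp
        qed
      qed
      \<comment> \<open>Variables, levels and sets of variables are finite in number, so all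
        comparisons hold simultaneously at almost every index.\<close>
      have "\<forall>\<^sub>F i in D. (\<forall>x\<in>V. \<forall>y\<in>V. F (rep b') x i = F (rep b') y i \<longleftrightarrow> F b x i = F b y i) \<and>
        (\<forall>x\<in>V. \<forall>n\<in>{..<m}. br (F (rep b') x i) n = br (F b x i) n) \<and>
        (\<forall>S\<in>Pow V. (\<lambda>x. F (rep b') x i) ` S \<in> r \<longleftrightarrow> (\<lambda>x. F b x i) ` S \<in> r)"
        by (intro eventually_conj eventually_ball_finite ballI eq_ev br_ev r_ev) (use fin_V in auto)
      then have "\<forall>\<^sub>F i in D. same_type br r m V (\<lambda>x. F (rep b') x i) (\<lambda>x. F b x i)"
        by (rule eventually_mono) (auto simp: same_type_def)
      moreover have "\<forall>\<^sub>F i in D. sat M (\<lambda>x. F (rep b') x i) p"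
        using sat_F[OF b'C(1)] b'(2) b'C(2) by (simp add: sol_def)
      ultimately have "\<forall>\<^sub>F i in D. sat M (\<lambda>x. F b x i) p"
      proof eventually_elim
        case (elim i)
        have "F z x i \<in> C" if "z \<in> UNIV \<rightarrow> C" for z x using F[OF that, of x] by (auto simp: C_def)
        then have "sat M (\<lambda>x. F (rep b') x i) p \<longleftrightarrow> sat M (\<lambda>x. F b x i) p"
          using m[OF _ _ elim(1)] b'C(1) bC by blast
        then show ?case using elim(2) by simp
      qed
      then show ?thesis using sat_F[OF bC] by (simp add: B_def)
    qed
    then show ?thesis using BN unfolding carrier_N by blast
  qed
qed

end
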